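(* Let $m\ge 3$ be an integer, $a_0\in\mathbb{C}$, and $f(z)=z^{m}+a_{0}$. If $\Omega(f)$ is simply connected, then the Brennan conjecture holds for $\Omega(f)$.
   Context: For a polynomial $f$ of degree $\ge 2$, the basin of attraction of infinity is $\Omega(f)=\{z\in\hat{\mathbb{C}}: f^{n}(z)\to\infty \text{ as } n\to+\infty\}$, where $f^n$ denotes the $n$-th iterate (it contains $\infty$). We say the Brennan conjecture holds for a simply connected domain $\Omega\subsetneq\hat{\mathbb{C}}$ if for a (equivalently any) biholomorphic map $F:\Omega\to\mathbb{D}$ onto the unit disk and every $p\in(\tfrac43,4)$, one has $\int_{\Omega\cap\mathbb{C}}|F'(z)|^{p}\,dA(z)<+\infty$, where $dA$ is Lebesgue area measure. *)

theory Defs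
  imports "HOL-Analysis.Analysis"
begin

text \<open>Basin of attraction of infinity, finite part: \<Omega>(f) \<inter> \<complex>.
  The full basin is this set together with the point \<infinity>.\<close>
definition basin_infinity :: "(complex \<Rightarrow> complex) \<Rightarrow> complex set" where
  "basin_infinity f = {z. filterlim (\<lambda>n. (f ^^ n) z) at_infinity sequentially}"

text \<open>Riemann sphere realised as the unit sphere in \<complex> \<times> \<real> via inverse
  stereographic projection; the north pole (0,1) represents \<infinity>.\<close>
definition sphere_pt :: "complex \<Rightarrow> complex \<times> real" where
  "sphere_pt z = (z * of_real (2 / (1 + (cmod z)\<^sup>2)),
                  ((cmod z)\<^sup>2 - 1) / ((cmod z)\<^sup>2 + 1))"

definition sphere_infty :: "complex \<times> real" where
  "sphere_infty = (0, 1)"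

definition with_infty :: "complex set \<Rightarrow> (complex \<times> real) set" where
  "with_infty A = sphere_pt ` A \<union> {sphere_infty}"

text \<open>F on A, with value Finf at \<infinity>, is a biholomorphic map of A \<union> {\<infinity>} onto the unit disk:
  holomorphic on A, holomorphic at \<infinity> (in the chart w = 1/z), and bijective onto the disk.\<close>
definition biholo_to_disk_infty ::
    "complex set \<Rightarrow> (complex \<Rightarrow> complex) \<Rightarrow> complex \<Rightarrow> bool" where
  "biholo_to_disk_infty A F Finf \<longleftrightarrow>
     F holomorphic_on A \<and>
     (\<exists>r>0. {z. r < cmod z} \<subseteq> A \<and>
        (\<lambda>w. if w = 0 then Finf else F (1 / w)) holomorphic_on ball 0 (1 / r)) \<and>
     inj_on F A \<and> Finf \<notin> F ` A \<and> F ` A \<union> {Finf} = ball 0 1"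

definition brennan_holds_infty :: "complex set \<Rightarrow> bool" where
  "brennan_holds_infty A \<longleftrightarrow>
     (\<forall>F Finf. biholo_to_disk_infty A F Finf \<longrightarrow>
        (\<forall>p::real. 4/3 < p \<and> p < 4 \<longrightarrow>
           (\<integral>\<^sup>+ z\<in>A. ennreal ((cmod (deriv F z)) powr p) \<partial>lborel) < \<infinity>))"

end

theory Submission
  imports Defs "HOL-Complex_Analysis.Complex_Analysis"
    "HOL-Computational_Algebra.Fundamental_Theorem_Algebra"
begin

text \<open>
  After a Moebius change the Riemann map \<open>F\<close> sends \<open>\<infinity>\<close> to \<open>0\<close>, and then \<open>F \<circ> f = c F\<^sup>m\<close> with
  \<open>|c| = 1\<close>, because \<open>F \<circ> f / F\<^sup>m\<close> is holomorphic and zero-free on the disk with boundary modulus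
  \<open>1\<close>. Differentiating at the critical point \<open>0\<close> shows that \<open>0\<close> cannot escape, so
  \<open>|a|\<^sup>2 \<le> 2\<close>. On the set \<open>A n\<close> of points leaving \<open>{|z|\<^sup>2 \<le> 5/2}\<close> at time \<open>n\<close> the conjugacy
  gives \<open>|F'| \<le> C |(f ^^ n)'| / m ^ n\<close>, which reduces the claim to the case \<open>p = 4\<close>, i.e. to
  summability of \<open>m ^ (-4n)\<close> times the integral of \<open>|(f ^^ n)'| ^ 4\<close> over \<open>A n\<close>.

  Changing variables along \<open>f\<close> turns this integral into an iterated transfer operator. The \<open>m\<close>
  preimages of a point are \<open>\<omega> w\<close> with \<open>\<omega> ^ m = 1\<close>, and \<open>|\<omega> w - a|\<^sup>2\<close> has mean
  \<open>|w|\<^sup>2 + |a|\<^sup>2 \<le> 5\<close>. By concavity each step multiplies \<open>m ^ (-4n)\<close> times the integral by at most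
  \<open>5 powr ((m - 1) / m) / m\<close>, which is less than \<open>1\<close> for \<open>m \<ge> 3\<close>.
\<close>

section \<open>Change of variables in the plane\<close>

text \<open>The Jacobian formula for image measures is applied in \<open>real^2\<close>, where
  linear maps have matrices and determinants; \<open>complex_of_vec\<close> carries it over to the
  complex plane.\<close>

definition complex_of_vec :: "real^2 \<Rightarrow> complex" where
  "complex_of_vec v = Complex (v $ 1) (v $ 2)"

definition vec_of_complex :: "complex \<Rightarrow> real^2" where
  "vec_of_complex z = vector [Re z, Im z]"

lemma complex_of_vec_of_complex [simp]: "complex_of_vec (vec_of_complex z) = z"
  by (simp add: complex_of_vec_def vec_of_complex_def)

lemma vec_of_complex_of_vec [simp]: "vec_of_complex (complex_of_vec v) = v"
  by (simp add: complex_of_vec_def vec_of_complex_def vec_eq_iff forall_2)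

lemma bounded_linear_complex_of_vec: "bounded_linear complex_of_vec"
  by (rule linear_conv_bounded_linear[THEN iffD1])
     (auto intro!: linearI simp: complex_of_vec_def complex_eq_iff)

lemma bounded_linear_vec_of_complex: "bounded_linear vec_of_complex"
  by (rule linear_conv_bounded_linear[THEN iffD1])
     (auto intro!: linearI simp: vec_of_complex_def vec_eq_iff forall_2)

lemma measurable_complex_of_vec [measurable]: "complex_of_vec \<in> borel_measurable borel"
  by (intro borel_measurable_continuous_onI linear_continuous_on bounded_linear_complex_of_vec)

text \<open>A measure that gives every box its volume is \<open>lborel\<close>, and the preimage of
  a complex box is the box with the same coordinates.\<close>

lemma lborel_complex_eq_distr: "(lborel :: complex measure) = distr lborel borel complex_of_vec"
proof (rule lborel_eqI)
  fix l u :: complex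
  assume le: "\<And>b. b \<in> Basis \<Longrightarrow> l \<bullet> b \<le> u \<bullet> b"
  have "complex_of_vec -` box l u = box (vec_of_complex l) (vec_of_complex u)"
    unfolding set_eq_iff vimage_eq mem_box_cart
    by (auto simp: box_def Basis_complex_def complex_of_vec_def vec_of_complex_def forall_2)
  moreover have "Re l \<le> Re u" "Im l \<le> Im u"
    using le[of 1] le[of \<i>] by (auto simp: Basis_complex_def)
  ultimately show "emeasure (distr lborel borel complex_of_vec) (box l u) = (\<Prod>b\<in>Basis. (u - l) \<bullet> b)"
    by (auto simp: emeasure_distr emeasure_lborel_box_eq Basis_complex_def Basis_vec_def
        inner_axis inner_diff_left UNIV_2 axis_eq_axis vec_of_complex_def)
qed simp

lemma nn_integral_complex_of_vec:
  assumes "g \<in> borel_measurable borel"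
  shows "(\<integral>\<^sup>+ z. g z \<partial>lborel) = (\<integral>\<^sup>+ v. g (complex_of_vec v) \<partial>lborel)"
  using assms by (subst lborel_complex_eq_distr) (simp add: nn_integral_distr)

text \<open>With \<open>c = x + iy\<close> the matrix has rows \<open>(x, -y)\<close> and
  \<open>(y, x)\<close>; so the real Jacobian of a complex differentiable map is the squared modulus
  of its derivative.\<close>

lemma det_matrix_complex_mult:
  "det (matrix (\<lambda>v. vec_of_complex (c * complex_of_vec v))) = (cmod c)\<^sup>2"
  by (simp add: det_2 matrix_def complex_of_vec_def vec_of_complex_def axis_def cmod_power2)
     (simp add: power2_eq_square)

text \<open>By injectivity the left side is the area of the part of the image of \<open>S\<close>
  that lies in \<open>E\<close>.\<close>

lemma emeasure_change_of_variables_le: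
  fixes \<phi> \<phi>' :: "complex \<Rightarrow> complex"
  assumes S: "S \<in> sets borel"
    and der: "\<And>w. w \<in> S \<Longrightarrow> (\<phi> has_field_derivative \<phi>' w) (at w)"
    and inj: "inj_on \<phi> S"
    and [measurable]: "\<phi> \<in> borel_measurable borel" "\<phi>' \<in> borel_measurable borel"
    and E: "E \<in> sets borel"
  shows "(\<integral>\<^sup>+ w. ennreal ((cmod (\<phi>' w))\<^sup>2) * indicator (S \<inter> \<phi> -` E) w \<partial>lborel) \<le> emeasure lborel E"
proof (cases "emeasure lborel E = \<infinity>")
  case False
  note [measurable] = S E
  define T where "T = complex_of_vec -` (S \<inter> \<phi> -` E)"
  define \<psi> where "\<psi> v = vec_of_complex (\<phi> (complex_of_vec v))" for v
  define \<psi>' where "\<psi>' v h = vec_of_complex (\<phi>' (complex_of_vec v) * complex_of_vec h)" for v h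
  define W where "W = complex_of_vec -` E"
  have T: "T \<in> sets borel"
    unfolding T_def by (rule measurable_sets_borel[OF measurable_complex_of_vec]) (measurable)
  have W: "W \<in> sets borel"
    unfolding W_def by (rule measurable_sets_borel[OF measurable_complex_of_vec]) (measurable)
  have emW: "emeasure lborel W = emeasure lborel E"
    by (subst lborel_complex_eq_distr) (simp add: emeasure_distr W_def)
  have derT: "(\<psi> has_derivative \<psi>' v) (at v within T)" if "v \<in> T" for v
  proof -
    have "(\<phi> has_derivative (\<lambda>h. \<phi>' (complex_of_vec v) * h)) (at (complex_of_vec v))"
      using der that unfolding T_def has_field_derivative_def by blast
    from has_derivative_compose[OF bounded_linear.has_derivative[OF bounded_linear_complex_of_vec has_derivative_ident] this]
    have "((\<lambda>v. \<phi> (complex_of_vec v)) has_derivative (\<lambda>h. \<phi>' (complex_of_vec v) * complex_of_vec h)) (at v within T)" .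
    from bounded_linear.has_derivative[OF bounded_linear_vec_of_complex this]
    show ?thesis unfolding \<psi>_def[abs_def] \<psi>'_def[abs_def] .
  qed
  have injT: "inj_on \<psi> T"
  proof (rule inj_onI)
    fix x y assume xy: "x \<in> T" "y \<in> T" "\<psi> x = \<psi> y"
    from xy(3) have "\<phi> (complex_of_vec x) = \<phi> (complex_of_vec y)"
      unfolding \<psi>_def by (metis complex_of_vec_of_complex)
    with xy inj have "complex_of_vec x = complex_of_vec y"
      unfolding T_def inj_on_def by blast
    then show "x = y" by (metis vec_of_complex_of_vec)
  qed
  \<comment> \<open>Differentiable maps of the plane send Lebesgue measurable sets to such sets.
    Lying in \<open>W\<close>, the image also has finite measure, as the Jacobian formula
    requires.\<close>
  have "\<psi> ` T \<in> sets lebesgue"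
    by (rule differentiable_image_in_sets_lebesgue)
       (use T derT in \<open>auto simp: differentiable_on_def differentiable_def\<close>)
  moreover have sub: "\<psi> ` T \<subseteq> W"
    by (auto simp: \<psi>_def T_def W_def)
  moreover have Wl: "W \<in> lmeasurable"
    using W emW False by (auto simp: fmeasurable_def top.not_eq_extremum)
  ultimately have im: "\<psi> ` T \<in> lmeasurable"
    using fmeasurableI2 by blast
  have "((\<lambda>v. \<bar>det (matrix (\<psi>' v))\<bar>) has_integral measure lebesgue (\<psi> ` T)) T"
    using has_measure_differentiable_image[of T \<psi> \<psi>' "measure lebesgue (\<psi> ` T)"] T derT injT im by auto
  then have "((\<lambda>v. (cmod (\<phi>' (complex_of_vec v)))\<^sup>2) has_integral measure lebesgue (\<psi> ` T)) T"
    by (simp add: \<psi>'_def[abs_def] det_matrix_complex_mult)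
  then have "(\<integral>\<^sup>+ v. ennreal ((cmod (\<phi>' (complex_of_vec v)))\<^sup>2) * indicator T v \<partial>lborel) = measure lebesgue (\<psi> ` T)"
    by (intro nn_integral_has_integral_lebesgue') auto
  also have "\<dots> \<le> measure lebesgue W"
    using sub im Wl by (intro ennreal_leI measure_mono_fmeasurable) auto
  also have "\<dots> = emeasure lborel E"
    using Wl W emW emeasure_eq_measure2 by fastforce
  finally have "(\<integral>\<^sup>+ v. ennreal ((cmod (\<phi>' (complex_of_vec v)))\<^sup>2) * indicator T v \<partial>lborel) \<le> emeasure lborel E" .
  then show ?thesis
    by (subst nn_integral_complex_of_vec) (auto simp: T_def indicator_def)
qed simp

text \<open>The inequality for sets says that the push-forward \<open>M\<close> of the Jacobian
  density on \<open>S\<close> is dominated by \<open>lborel\<close>, and integrals are monotone in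
  the measure.\<close>

lemma nn_integral_change_of_variables_le:
  fixes \<phi> \<phi>' :: "complex \<Rightarrow> complex"
  assumes S: "S \<in> sets borel"
    and der: "\<And>w. w \<in> S \<Longrightarrow> (\<phi> has_field_derivative \<phi>' w) (at w)"
    and inj: "inj_on \<phi> S"
    and [measurable]: "\<phi> \<in> borel_measurable borel" "\<phi>' \<in> borel_measurable borel"
      "G \<in> borel_measurable borel"
  shows "(\<integral>\<^sup>+ w. G (\<phi> w) * ennreal ((cmod (\<phi>' w))\<^sup>2) * indicator S w \<partial>lborel) \<le> (\<integral>\<^sup>+ z. G z \<partial>lborel)"
proof -
  note [measurable] = S
  define M where "M = distr (density lborel (\<lambda>w. ennreal ((cmod (\<phi>' w))\<^sup>2) * indicator S w)) borel \<phi>"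
  have "(\<integral>\<^sup>+ w. G (\<phi> w) * ennreal ((cmod (\<phi>' w))\<^sup>2) * indicator S w \<partial>lborel) = (\<integral>\<^sup>+ z. G z \<partial>M)"
    unfolding M_def by (simp add: nn_integral_distr nn_integral_density mult_ac)
  also have "\<dots> \<le> (\<integral>\<^sup>+ z. G z \<partial>lborel)"
  proof (rule nn_integral_mono_measure)
    show "sets M = sets lborel" by (simp add: M_def)
    have "emeasure M E \<le> emeasure lborel E" if "E \<in> sets borel" for E
    proof -
      note [measurable] = that
      have "\<phi> -` E \<in> sets borel"
        by (rule measurable_sets_borel[of \<phi> borel]) (use that in auto)
      then have "emeasure M E = (\<integral>\<^sup>+ w. ennreal ((cmod (\<phi>' w))\<^sup>2) * indicator (S \<inter> \<phi> -` E) w \<partial>lborel)"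
        unfolding M_def
        by (subst emeasure_distr, simp, simp, subst emeasure_density)
           (auto intro!: nn_integral_cong simp: indicator_def)
      also have "\<dots> \<le> emeasure lborel E"
        by (rule emeasure_change_of_variables_le) (use assms that in auto)
      finally show ?thesis .
    qed
    \<comment> \<open>The order on measures compares \<open>emeasure\<close> on all sets; on sets
      that are not Borel it is 0 by convention.\<close>
    then show "M \<le> lborel"
      by (auto simp: le_measure_iff M_def le_fun_def) (metis emeasure_notin_sets sets_distr zero_le)
  qed
  finally show ?thesis .
qed

section \<open>Averaging over the \<open>m\<close>-th roots of unity\<close>

lemma norm_root_of_unity:
  fixes \<omega> :: complex
  assumes "\<omega> ^ m = 1" "m > 0"
  shows "cmod \<omega> = 1"
  using power_eq_imp_eq_norm[of \<omega> m 1] assms by simp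

text \<open>The change of variables gives one inequality; the inverse rotation gives the
  other.\<close>

lemma nn_integral_rotate:
  fixes G :: "complex \<Rightarrow> ennreal"
  assumes G: "G \<in> borel_measurable borel" and w: "cmod \<omega> = 1"
  shows "(\<integral>\<^sup>+ z. G (\<omega> * z) \<partial>lborel) = (\<integral>\<^sup>+ z. G z \<partial>lborel)"
proof -
  have le: "(\<integral>\<^sup>+ z. K (c * z) \<partial>lborel) \<le> (\<integral>\<^sup>+ z. K z \<partial>lborel)"
    if "K \<in> borel_measurable borel" "cmod c = 1" for K :: "complex \<Rightarrow> ennreal" and c
  proof -
    have "c \<noteq> 0" using that by auto
    then have "inj_on ((*) c) UNIV" by (auto simp: inj_on_def)
    then show ?thesis
      using nn_integral_change_of_variables_le[of UNIV "\<lambda>z. c * z" "\<lambda>_. c" K] that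
      by (auto intro!: derivative_eq_intros)
  qed
  have "\<omega> \<noteq> 0" using w by auto
  have [measurable]: "(\<lambda>z. G (\<omega> * z)) \<in> borel_measurable borel" using G by measurable
  show ?thesis
    using le[OF G w] le[of "\<lambda>z. G (\<omega> * z)" "inverse \<omega>"] w \<open>\<omega> \<noteq> 0\<close>
    by (simp add: norm_inverse flip: mult.assoc)
qed

text \<open>Rotating the variable fixes \<open>P\<close>, so \<open>h\<close> may be replaced by its
  mean over the rotations. The mean has to be bounded only where \<open>P\<close> does not vanish,
  which lets \<open>P\<close> carry a cutoff.\<close>

lemma nn_integral_invariant_mult_le:
  fixes P :: "complex \<Rightarrow> ennreal" and h :: "complex \<Rightarrow> real"
  assumes [measurable]: "P \<in> borel_measurable borel" "h \<in> borel_measurable borel"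
    and m: "m > 0"
    and inv: "\<And>\<omega> z. \<omega> ^ m = 1 \<Longrightarrow> P (\<omega> * z) = P z"
    and h: "\<And>z. h z \<ge> 0"
    and avg: "\<And>z. P z \<noteq> 0 \<Longrightarrow> (\<Sum>\<omega> | \<omega> ^ m = 1. h (\<omega> * z)) \<le> real m * B"
  shows "(\<integral>\<^sup>+ z. P z * h z \<partial>lborel) \<le> ennreal B * (\<integral>\<^sup>+ z. P z \<partial>lborel)"
proof -
  let ?U = "{\<omega>::complex. \<omega> ^ m = 1}"
  have fin: "finite ?U" and card: "card ?U = m"
    using m by (auto simp: finite_roots_unity card_roots_unity_eq)
  have "of_nat m * (\<integral>\<^sup>+ z. P z * h z \<partial>lborel) = (\<Sum>\<omega>\<in>?U. (\<integral>\<^sup>+ z. P z * h z \<partial>lborel))"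
    using card by simp
  also have "\<dots> = (\<Sum>\<omega>\<in>?U. (\<integral>\<^sup>+ z. P z * h (\<omega> * z) \<partial>lborel))"
  proof (rule sum.cong[OF refl])
    fix \<omega> assume "\<omega> \<in> ?U"
    then have w: "\<omega> ^ m = 1" by simp
    then have "cmod \<omega> = 1" using m by (rule norm_root_of_unity)
    then show "(\<integral>\<^sup>+ z. P z * h z \<partial>lborel) = (\<integral>\<^sup>+ z. P z * h (\<omega> * z) \<partial>lborel)"
      using nn_integral_rotate[of "\<lambda>z. P z * ennreal (h z)" \<omega>] by (simp add: inv[OF w])
  qed
  also have "\<dots> = (\<integral>\<^sup>+ z. P z * ennreal (\<Sum>\<omega>\<in>?U. h (\<omega> * z)) \<partial>lborel)"
    by (subst nn_integral_sum[symmetric]) (auto simp: h sum_ennreal sum_distrib_left[symmetric])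
  also have "\<dots> \<le> (\<integral>\<^sup>+ z. ennreal (real m * B) * P z \<partial>lborel)"
  proof (rule nn_integral_mono)
    fix z
    show "P z * ennreal (\<Sum>\<omega>\<in>?U. h (\<omega> * z)) \<le> ennreal (real m * B) * P z"
      using avg[of z] by (cases "P z = 0") (auto simp: mult.commute[of _ "P z"] intro!: mult_left_mono ennreal_leI)
  qed
  also have "\<dots> = of_nat m * (ennreal B * (\<integral>\<^sup>+ z. P z \<partial>lborel))"
    by (simp add: nn_integral_cmult ennreal_mult' mult.assoc ennreal_of_nat_eq_real_of_nat)
  finally show ?thesis
    using m by (simp add: ennreal_mult_le_mult_iff)
qed

text \<open>The map is injective on a sector of opening 2 pi / m, whose \<open>m\<close> rotated
  copies cover the plane apart from 0 and contribute equally.\<close>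

lemma nn_integral_power_map_le:
  fixes G :: "complex \<Rightarrow> ennreal"
  assumes [measurable]: "G \<in> borel_measurable borel" and m: "m > 0"
  shows "(\<integral>\<^sup>+ w. G (w ^ m + a) * ennreal ((cmod (of_nat m * w ^ (m - 1)))\<^sup>2) \<partial>lborel)
         \<le> of_nat m * (\<integral>\<^sup>+ z. G z \<partial>lborel)"
proof -
  let ?U = "{\<omega>::complex. \<omega> ^ m = 1}"
  define P where "P w = G (w ^ m + a) * ennreal ((cmod (of_nat m * w ^ (m - 1)))\<^sup>2)" for w
  \<comment> \<open>The sector of arguments in (-pi/m, pi/m]. Written with \<open>Ln\<close>, it
    makes \<open>w ^ m\<close> determine \<open>w\<close> at once.\<close>
  define S where "S = {w. w \<noteq> 0 \<and> Ln (w ^ m) = of_nat m * Ln w}"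
  have fin: "finite ?U" and card: "card ?U = m"
    using m by (auto simp: finite_roots_unity card_roots_unity_eq)
  have [measurable]: "P \<in> borel_measurable borel" unfolding P_def by measurable
  have S [measurable]: "S \<in> sets borel" unfolding S_def by measurable
  have inj: "inj_on (\<lambda>w. w ^ m + a) S"
  proof (rule inj_onI)
    fix x y assume "x \<in> S" "y \<in> S" "x ^ m + a = y ^ m + a"
    then have "of_nat m * Ln x = of_nat m * Ln y" "x \<noteq> 0" "y \<noteq> 0" by (auto simp: S_def)
    then show "x = y" using m by (metis exp_Ln mult_cancel_left of_nat_eq_0_iff less_numeral_extra(3))
  qed
  note unit = norm_root_of_unity[OF _ m]
  \<comment> \<open>\<open>v\<close> is the principal \<open>m\<close>-th root of
    \<open>w ^ m\<close>; it lies in \<open>S\<close> and differs from \<open>w\<close> by a root of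
    unity.\<close>
  have cover: "\<exists>\<omega>\<in>?U. \<omega> * w \<in> S" if "w \<noteq> 0" for w
  proof -
    define v where "v = exp (Ln (w ^ m) / of_nat m)"
    have vm: "v ^ m = w ^ m"
      using m that by (simp add: v_def flip: exp_of_nat_mult)
    have *: "Im (Ln (w ^ m)) \<in> {-pi<..pi}"
      using that Im_Ln_le_pi[of "w ^ m"] mpi_less_Im_Ln[of "w ^ m"] by auto
    have "- pi < Im (Ln (w ^ m)) / real m" "Im (Ln (w ^ m)) / real m \<le> pi"
    proof -
      have "1 \<le> real m" using m by simp
      then have "pi \<le> pi * real m" using pi_gt_zero by simp
      then have "- (pi * real m) < Im (Ln (w ^ m))" "Im (Ln (w ^ m)) \<le> pi * real m"
        using * unfolding greaterThanAtMost_iff by linarith+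
      then show "- pi < Im (Ln (w ^ m)) / real m" "Im (Ln (w ^ m)) / real m \<le> pi"
        using m by (auto simp: pos_less_divide_eq pos_divide_le_eq)
    qed
    then have "Ln v = Ln (w ^ m) / of_nat m"
      unfolding v_def by (intro Ln_exp) auto
    then have "v \<in> S" unfolding S_def using m by (simp add: vm) (simp add: v_def)
    moreover have "(v / w) ^ m = 1" using that by (simp add: power_divide vm)
    ultimately show ?thesis using that by (intro bexI[of _ "v / w"]) auto
  qed
  have "(\<integral>\<^sup>+ w. P w \<partial>lborel) \<le> (\<integral>\<^sup>+ w. (\<Sum>\<omega>\<in>?U. P w * indicator S (\<omega> * w)) \<partial>lborel)"
  proof (rule nn_integral_mono_AE)
    have "AE w in lborel. w \<noteq> (0::complex)"
      by (rule AE_lborel_singleton)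
    then show "AE w in lborel. P w \<le> (\<Sum>\<omega>\<in>?U. P w * indicator S (\<omega> * w))"
    proof eventually_elim
      fix w :: complex assume "w \<noteq> 0"
      then obtain \<omega> where w: "\<omega> \<in> ?U" "\<omega> * w \<in> S" using cover by blast
      have "P w = P w * indicator S (\<omega> * w)" using w by simp
      also have "\<dots> \<le> (\<Sum>\<omega>\<in>?U. P w * indicator S (\<omega> * w))"
        by (rule member_le_sum) (use w fin in auto)
      finally show "P w \<le> (\<Sum>\<omega>\<in>?U. P w * indicator S (\<omega> * w))" .
    qed
  qed
  also have "\<dots> = (\<Sum>\<omega>\<in>?U. (\<integral>\<^sup>+ w. P w * indicator S (\<omega> * w) \<partial>lborel))"
    by (rule nn_integral_sum) measurable
  also have "\<dots> = (\<Sum>\<omega>\<in>?U. (\<integral>\<^sup>+ w. P w * indicator S w \<partial>lborel))"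
  proof (rule sum.cong[OF refl])
    fix \<omega> assume "\<omega> \<in> ?U"
    then have w: "\<omega> ^ m = 1" by simp
    have "P (\<omega> * w) = P w" for w
      using unit[OF w] w by (simp add: P_def power_mult_distrib norm_mult norm_power)
    then show "(\<integral>\<^sup>+ w. P w * indicator S (\<omega> * w) \<partial>lborel) = (\<integral>\<^sup>+ w. P w * indicator S w \<partial>lborel)"
      using nn_integral_rotate[of "\<lambda>w. P w * indicator S w" \<omega>] unit[OF w] by simp
  qed
  also have "\<dots> = of_nat m * (\<integral>\<^sup>+ w. P w * indicator S w \<partial>lborel)"
    using card by simp
  also have "\<dots> \<le> of_nat m * (\<integral>\<^sup>+ z. G z \<partial>lborel)"
    unfolding P_def
    by (intro mult_left_mono nn_integral_change_of_variables_le inj S)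
       (auto intro!: derivative_eq_intros)
  finally show ?thesis unfolding P_def .
qed

section \<open>Fourth moments of the derivatives of the iterates\<close>

text \<open>Expanding the square leaves a cross term linear in \<omega>, and the roots of unity add
  up to 0 once \<open>m > 1\<close>.\<close>

lemma sum_norm_square_rotations:
  fixes z a :: complex
  assumes "m > 1"
  shows "(\<Sum>\<omega> | \<omega> ^ m = 1. (cmod (\<omega> * z - a))\<^sup>2) = real m * ((cmod z)\<^sup>2 + (cmod a)\<^sup>2)"
proof -
  let ?U = "{\<omega>::complex. \<omega> ^ m = 1}"
  have card: "card ?U = m"
    using assms by (simp add: card_roots_unity_eq)
  have "(\<Sum>\<omega>\<in>?U. (cmod (\<omega> * z - a))\<^sup>2) = (\<Sum>\<omega>\<in>?U. (cmod z)\<^sup>2 + (cmod a)\<^sup>2 - 2 * Re (\<omega> * (z * cnj a)))"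
  proof (rule sum.cong[OF refl])
    fix \<omega> assume "\<omega> \<in> ?U"
    then have "cmod \<omega> = 1" using assms by (auto intro: norm_root_of_unity)
    then have "(cmod (\<omega> * z))\<^sup>2 = (cmod z)\<^sup>2" by (simp add: norm_mult)
    moreover have "(cmod (u - a))\<^sup>2 = (cmod u)\<^sup>2 + (cmod a)\<^sup>2 - 2 * Re (u * cnj a)" for u
      unfolding cmod_power2 by (simp add: power2_eq_square algebra_simps)
    ultimately show "(cmod (\<omega> * z - a))\<^sup>2 = (cmod z)\<^sup>2 + (cmod a)\<^sup>2 - 2 * Re (\<omega> * (z * cnj a))"
      by (simp only: mult.assoc)
  qed
  also have "\<dots> = real m * ((cmod z)\<^sup>2 + (cmod a)\<^sup>2) - 2 * Re (\<Sum>\<omega>\<in>?U. \<omega> * (z * cnj a))"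
    by (simp add: sum_subtractf card sum_distrib_left)
  also have "(\<Sum>\<omega>\<in>?U. \<omega> * (z * cnj a)) = 0"
    using sum_roots_unity[OF assms] by (simp flip: sum_distrib_right)
  finally show ?thesis by simp
qed

text \<open>Concavity: the right side is the tangent at \<open>c\<close> to the power function. It
  comes from Young's inequality with second factor 1.\<close>

lemma powr_le_tangent:
  fixes x c \<alpha> :: real
  assumes "x \<ge> 0" "c > 0" "0 < \<alpha>" "\<alpha> < 1"
  shows "x powr \<alpha> \<le> c powr \<alpha> * (\<alpha> * (x / c) + (1 - \<alpha>))"
proof (cases "x = 0")
  case False
  then have "(x / c) powr \<alpha> * 1 powr (1 - \<alpha>) \<le> \<alpha> * (x / c) + (1 - \<alpha>) * 1"
    using assms by (intro Youngs_inequality_0) auto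
  then have "c powr \<alpha> * (x / c) powr \<alpha> \<le> c powr \<alpha> * (\<alpha> * (x / c) + (1 - \<alpha>))"
    by (intro mult_left_mono) auto
  then show ?thesis using assms by (simp add: powr_divide)
qed (use assms in auto)

section \<open>The map \<open>f\<close>, its iterates and the weight \<open>h\<close>\<close>

locale unicritical =
  fixes m :: nat and a :: complex
  assumes m3: "m \<ge> 3"
begin

definition f :: "complex \<Rightarrow> complex" where "f z = z ^ m + a"

text \<open>By the chain rule this is the derivative of \<open>f ^^ n\<close> at
  \<open>w\<close>.\<close>

definition iter_deriv :: "nat \<Rightarrow> complex \<Rightarrow> complex" where
  "iter_deriv n w = (\<Prod>k<n. of_nat m * (f ^^ k) w ^ (m - 1))"

text \<open>Approximate eigenfunction of the transfer operator with weight \<open>|f'|\<^sup>2\<close>. Since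
  \<open>h (f w) = |w| ^ (2 * (m - 1))\<close>, all preimages of a point carry the same weight, and only \<open>h\<close>
  itself has to be averaged over them.\<close>
definition h :: "complex \<Rightarrow> real" where
  "h z = cmod (z - a) powr (2 * (real m - 1) / real m)"

text \<open>The threshold 5/2 serves twice: inside it, |z|^2 + |a|^2 is at most 5 when |a|^2 \<le>
  5/2, and from it on every point escapes when |a|^2 \<le> 2. The bound \<open>R\<close> keeps the
  set of exit points bounded.\<close>

definition escape_set :: "real \<Rightarrow> nat \<Rightarrow> complex set" where
  "escape_set R n = {w. (\<forall>k<n. (cmod ((f ^^ k) w))\<^sup>2 \<le> 5/2) \<and>
     5/2 < (cmod ((f ^^ n) w))\<^sup>2 \<and> cmod ((f ^^ n) w) \<le> R}"

text \<open>Jensen's bound for the mean of \<open>h\<close> over the rotations: \<open>h\<close> is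
  the power (m - 1) / m of |z - a|^2, whose mean is at most 5.\<close>

definition growth :: real where
  "growth = 5 powr ((real m - 1) / real m)"

lemma iter_deriv_Suc: "iter_deriv (Suc n) w = iter_deriv n (f w) * (of_nat m * w ^ (m - 1))"
  by (simp add: iter_deriv_def prod.lessThan_Suc_shift funpow_swap1 mult.commute del: prod.lessThan_Suc)

lemma escape_set_Suc: "w \<in> escape_set R (Suc n) \<longleftrightarrow> (cmod w)\<^sup>2 \<le> 5/2 \<and> f w \<in> escape_set R n"
  by (auto simp: escape_set_def All_less_Suc2 funpow_swap1)

lemma measurable_f [measurable]: "f \<in> borel_measurable borel"
  unfolding f_def[abs_def] by measurable

lemma measurable_funpow_f [measurable]: "f ^^ n \<in> borel_measurable borel"
  by (induction n) (auto simp: o_def id_def intro: measurable_compose[OF _ measurable_f])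

lemma measurable_iter_deriv [measurable]: "iter_deriv n \<in> borel_measurable borel"
  unfolding iter_deriv_def[abs_def] by measurable

lemma measurable_h [measurable]: "h \<in> borel_measurable borel"
  unfolding h_def[abs_def] by measurable

lemma sets_escape_set [measurable]: "escape_set R n \<in> sets borel"
  unfolding escape_set_def by measurable

lemma h_nonneg [simp]: "h z \<ge> 0"
  by (simp add: h_def)

lemma h_f: "h (f w) = cmod w ^ (2 * (m - 1))"
proof (cases "w = 0")
  case False
  then have "h (f w) = (cmod w powr real m) powr (2 * (real m - 1) / real m)"
    by (simp add: h_def f_def norm_power powr_realpow)
  also have "\<dots> = cmod w powr (2 * (real m - 1))"
    using m3 by (simp add: powr_powr)
  also have "2 * (real m - 1) = real (2 * (m - 1))"
    using m3 by (simp add: of_nat_diff)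
  also have "cmod w powr \<dots> = cmod w ^ (2 * (m - 1))"
    using False by (intro powr_realpow) simp
  finally show ?thesis .
qed (use m3 in \<open>simp add: h_def f_def power_0_left\<close>)

lemma growth_nonneg: "growth \<ge> 0" by (simp add: growth_def)

text \<open>Equivalent to 5 ^ (m - 1) < m ^ m. At \<open>m = 3\<close> this is the narrow 25 < 27;
  for degree 2 it would read 5 < 4, so the restriction on the degree enters here.\<close>

lemma growth_less: "growth < real m"
proof -
  have "(5::nat) ^ (m - 1) < m ^ m"
  proof (cases "m \<le> 4")
    case True
    then have "m = 3 \<or> m = 4" using m3 by auto
    then show ?thesis by auto
  next
    case False
    have "(5::nat) ^ (m - 1) \<le> m ^ (m - 1)" using False by (intro power_mono) auto
    also have "\<dots> < m ^ m" using m3 by (intro power_strict_increasing) auto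
    finally show ?thesis .
  qed
  then have "(5::real) ^ (m - 1) < real m ^ m"
    by (metis of_nat_less_iff of_nat_numeral of_nat_power)
  then have "5 powr (real m - 1) < real m powr real m"
    using m3 by (simp add: powr_realpow of_nat_diff flip: powr_realpow)
  then have "(5 powr (real m - 1)) powr (1 / real m) < (real m powr real m) powr (1 / real m)"
    using m3 by (intro powr_less_mono2) auto
  then show ?thesis using m3 by (simp add: powr_powr growth_def)
qed

text \<open>Taking the tangent at 5 turns the mean of \<open>h\<close> into the mean of |\<omega> z
  - a|^2, which is known exactly.\<close>

lemma sum_h_rotations_le:
  assumes "(cmod z)\<^sup>2 + (cmod a)\<^sup>2 \<le> 5"
  shows "(\<Sum>\<omega> | \<omega> ^ m = 1. h (\<omega> * z)) \<le> real m * growth"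
proof -
  define \<alpha> where "\<alpha> = (real m - 1) / real m"
  have \<alpha>: "0 < \<alpha>" "\<alpha> < 1" using m3 by (auto simp: \<alpha>_def)
  have card: "card {\<omega>::complex. \<omega> ^ m = 1} = m"
    using m3 by (simp add: card_roots_unity_eq)
  have h: "h u = ((cmod (u - a))\<^sup>2) powr \<alpha>" for u
  proof (cases "u = a")
    case False
    then show ?thesis by (simp add: h_def \<alpha>_def powr_powr flip: powr_numeral)
  qed (use \<alpha> in \<open>simp add: h_def\<close>)
  have "(\<Sum>\<omega> | \<omega> ^ m = 1. h (\<omega> * z))
      \<le> (\<Sum>\<omega> | \<omega> ^ m = 1. 5 powr \<alpha> * (\<alpha> * ((cmod (\<omega> * z - a))\<^sup>2 / 5) + (1 - \<alpha>)))"
    unfolding h using \<alpha> by (intro sum_mono powr_le_tangent) auto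
  also have "\<dots> = 5 powr \<alpha> * (\<alpha> / 5 * (\<Sum>\<omega> | \<omega> ^ m = 1. (cmod (\<omega> * z - a))\<^sup>2) + real m * (1 - \<alpha>))"
    by (simp add: sum_distrib_left[symmetric] sum.distrib card sum_divide_distrib[symmetric])
  also have "\<dots> = 5 powr \<alpha> * (\<alpha> / 5 * (real m * ((cmod z)\<^sup>2 + (cmod a)\<^sup>2)) + real m * (1 - \<alpha>))"
    using m3 by (subst sum_norm_square_rotations) auto
  also have "\<dots> \<le> 5 powr \<alpha> * (\<alpha> / 5 * (real m * 5) + real m * (1 - \<alpha>))"
    using assms \<alpha> m3 by (intro mult_left_mono add_right_mono) auto
  also have "\<dots> = real m * growth"
    unfolding growth_def \<alpha>_def[symmetric] by (simp add: algebra_simps)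
  finally show ?thesis .
qed

section \<open>Recursion for the fourth moments\<close>

definition fourth_moment :: "real \<Rightarrow> nat \<Rightarrow> ennreal" where
  "fourth_moment R n = (\<integral>\<^sup>+ w. ennreal (cmod (iter_deriv n w) ^ 4) * indicator (escape_set R n) w \<partial>lborel)"

text \<open>The change of variables leaves a spare factor |f'|^2, which is \<open>h (f w)\<close> up
  to m^2. The recursion therefore closes on the moment weighted by \<open>h\<close>.\<close>

definition weighted_moment :: "real \<Rightarrow> nat \<Rightarrow> ennreal" where
  "weighted_moment R n = (\<integral>\<^sup>+ w. ennreal (cmod (iter_deriv n w) ^ 4 * h w) * indicator (escape_set R n) w \<partial>lborel)"

definition pull_density :: "real \<Rightarrow> nat \<Rightarrow> complex \<Rightarrow> ennreal" where
  "pull_density R n w =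
     (ennreal (real m ^ 2) * (ennreal (cmod (iter_deriv n (f w)) ^ 4 * h (f w)) * indicator (escape_set R n) (f w)))
     * ennreal ((cmod (of_nat m * w ^ (m - 1)))\<^sup>2)"

lemma measurable_pull_density [measurable]: "pull_density R n \<in> borel_measurable borel"
  unfolding pull_density_def[abs_def] by measurable

text \<open>The new factor |f'|^4 is split: one square is the Jacobian of \<open>f\<close>, the
  other is m^2 times \<open>h (f w)\<close>. The remaining indicator is the condition at time
  0.\<close>

lemma iter_deriv_Suc_eq_pull_density:
  "ennreal (cmod (iter_deriv (Suc n) w) ^ 4) * indicator (escape_set R (Suc n)) w
   = pull_density R n w * indicator {w. (cmod w)\<^sup>2 \<le> 5/2} w"
proof -
  have "(cmod (of_nat m * w ^ (m - 1))) ^ 4 = (cmod (of_nat m * w ^ (m - 1)))\<^sup>2 * (real m ^ 2 * h (f w))"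
  proof -
    have "(cmod (of_nat m * w ^ (m - 1)))\<^sup>2 = real m ^ 2 * h (f w)"
      by (simp add: h_f norm_mult norm_power power_mult_distrib mult.commute flip: power_mult)
    then show ?thesis
      by (metis power2_eq_square power4_eq_xxxx mult.assoc)
  qed
  then have "cmod (iter_deriv (Suc n) w) ^ 4 =
     (real m ^ 2 * (cmod (iter_deriv n (f w)) ^ 4 * h (f w))) * (cmod (of_nat m * w ^ (m - 1)))\<^sup>2"
    unfolding iter_deriv_Suc norm_mult[of "iter_deriv n (f w)"] power_mult_distrib
    by (simp add: mult_ac)
  then show ?thesis
    by (auto simp: pull_density_def escape_set_Suc indicator_def ennreal_mult)
qed

text \<open>Two of the three factors \<open>m\<close> come from the density, the third from
  \<open>f\<close> being \<open>m\<close> to one.\<close>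

lemma nn_integral_pull_density_le:
  "(\<integral>\<^sup>+ w. pull_density R n w \<partial>lborel) \<le> of_nat m ^ 3 * weighted_moment R n"
proof -
  have "(\<integral>\<^sup>+ w. pull_density R n w \<partial>lborel)
    \<le> of_nat m * (\<integral>\<^sup>+ z. ennreal (real m ^ 2) * (ennreal (cmod (iter_deriv n z) ^ 4 * h z) * indicator (escape_set R n) z) \<partial>lborel)"
    unfolding pull_density_def f_def
    by (rule nn_integral_power_map_le) (use m3 in \<open>auto simp flip: f_def\<close>)
  also have "\<dots> = of_nat m ^ 3 * weighted_moment R n"
    unfolding weighted_moment_def
    by (subst nn_integral_cmult) (auto simp: power_numeral_reduce mult.assoc ennreal_of_nat_eq_real_of_nat ennreal_mult)
  finally show ?thesis .
qed

lemma fourth_moment_Suc_le: "fourth_moment R (Suc n) \<le> of_nat m ^ 3 * weighted_moment R n"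
proof -
  have "fourth_moment R (Suc n) \<le> (\<integral>\<^sup>+ w. pull_density R n w \<partial>lborel)"
    unfolding fourth_moment_def iter_deriv_Suc_eq_pull_density
    by (intro nn_integral_mono) (auto simp: indicator_def)
  also note nn_integral_pull_density_le
  finally show ?thesis .
qed

text \<open>The pulled-back density depends on \<open>w\<close> only through \<open>w ^ m\<close>
  and |w|, so only the outer \<open>h\<close> is averaged over the rotations.\<close>

lemma weighted_moment_Suc_le:
  assumes "(cmod a)\<^sup>2 \<le> 5/2"
  shows "weighted_moment R (Suc n) \<le> ennreal growth * (of_nat m ^ 3 * weighted_moment R n)"
proof -
  \<comment> \<open>The cutoff stays in \<open>P\<close>: it is rotation invariant, and on it the
    bound on the mean of \<open>h\<close> is available.\<close>
  define P where "P w = pull_density R n w * indicator {w. (cmod w)\<^sup>2 \<le> 5/2} w" for w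
  have [measurable]: "P \<in> borel_measurable borel" unfolding P_def by measurable
  have inv: "P (\<omega> * w) = P w" if "\<omega> ^ m = 1" for \<omega> w
  proof -
    have "cmod \<omega> = 1" using that m3 by (auto intro: norm_root_of_unity)
    then show ?thesis using that
      by (simp add: P_def pull_density_def f_def power_mult_distrib norm_mult norm_power indicator_def)
  qed
  have "weighted_moment R (Suc n) = (\<integral>\<^sup>+ w. P w * ennreal (h w) \<partial>lborel)"
    unfolding weighted_moment_def P_def iter_deriv_Suc_eq_pull_density[symmetric]
    by (auto intro!: nn_integral_cong simp: ennreal_mult mult_ac)
  also have "\<dots> \<le> ennreal growth * (\<integral>\<^sup>+ w. P w \<partial>lborel)"
  proof (rule nn_integral_invariant_mult_le[where m = m])
    fix z assume "P z \<noteq> 0"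
    then have "(cmod z)\<^sup>2 \<le> 5/2" by (auto simp: P_def indicator_def split: if_splits)
    then show "(\<Sum>\<omega> | \<omega> ^ m = 1. h (\<omega> * z)) \<le> real m * growth"
      using assms by (intro sum_h_rotations_le) auto
  qed (use m3 inv in auto)
  also have "(\<integral>\<^sup>+ w. P w \<partial>lborel) \<le> (\<integral>\<^sup>+ w. pull_density R n w \<partial>lborel)"
    unfolding P_def by (intro nn_integral_mono) (auto simp: indicator_def)
  also note nn_integral_pull_density_le
  finally show ?thesis by (simp add: mult_left_mono)
qed

lemma weighted_moment_le:
  assumes "(cmod a)\<^sup>2 \<le> 5/2"
  shows "weighted_moment R n \<le> ennreal ((growth * real m ^ 3) ^ n) * weighted_moment R 0"
proof (induction n)
  case (Suc n)
  have "weighted_moment R (Suc n) \<le> ennreal growth * (of_nat m ^ 3 * weighted_moment R n)"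
    by (rule weighted_moment_Suc_le[OF assms])
  also have "\<dots> \<le> ennreal growth * (of_nat m ^ 3 * (ennreal ((growth * real m ^ 3) ^ n) * weighted_moment R 0))"
    by (intro mult_left_mono Suc) auto
  also have "\<dots> = ennreal ((growth * real m ^ 3) ^ Suc n) * weighted_moment R 0"
    by (simp add: ennreal_mult growth_nonneg ennreal_of_nat_eq_real_of_nat ennreal_power mult_ac)
  finally show ?case .
qed simp

lemma moments_0_finite: "fourth_moment R 0 < \<infinity>" "weighted_moment R 0 < \<infinity>"
proof -
  have sub: "escape_set R 0 \<subseteq> cball 0 R" by (auto simp: escape_set_def)
  then have em: "emeasure lborel (escape_set R 0) < \<infinity>"
    by (intro emeasure_bounded_finite bounded_subset[OF bounded_cball])
  then show "fourth_moment R 0 < \<infinity>" by (simp add: fourth_moment_def iter_deriv_def)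
  define C where "C = (R + cmod a) powr (2 * (real m - 1) / real m)"
  have "h w \<le> C" if "w \<in> escape_set R 0" for w
    using that norm_triangle_ineq4[of w a] m3
    by (auto simp: escape_set_def h_def C_def intro!: powr_mono2)
  then have "weighted_moment R 0 \<le> (\<integral>\<^sup>+ w. ennreal C * indicator (escape_set R 0) w \<partial>lborel)"
    unfolding weighted_moment_def
    by (intro nn_integral_mono) (auto simp: iter_deriv_def indicator_def intro!: ennreal_leI)
  also have "\<dots> < \<infinity>" using em by (simp add: nn_integral_cmult ennreal_mult_less_top)
  finally show "weighted_moment R 0 < \<infinity>" .
qed

lemma suminf_fourth_moment_finite:
  assumes "(cmod a)\<^sup>2 \<le> 5/2"
  shows "(\<Sum>n. ennreal (1 / real m ^ (4 * n)) * fourth_moment R n) < \<infinity>"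
proof -
  obtain K where K: "weighted_moment R 0 = ennreal K" "K \<ge> 0"
    using moments_0_finite(2)[of R] by (cases "weighted_moment R 0") auto
  \<comment> \<open>A step multiplies the weighted moment by at most
    \<open>growth * real m ^ 3\<close>, against a normalising factor m^(-4).\<close>
  define q where "q = growth / real m"
  have q: "0 \<le> q" "q < 1" using growth_nonneg growth_less m3 by (auto simp: q_def)
  have le: "ennreal (1 / real m ^ (4 * Suc n)) * fourth_moment R (Suc n) \<le> ennreal (K / real m * q ^ n)" for n
  proof -
    have "ennreal (1 / real m ^ (4 * Suc n)) * fourth_moment R (Suc n)
       \<le> ennreal (1 / real m ^ (4 * Suc n)) * (of_nat m ^ 3 * (ennreal ((growth * real m ^ 3) ^ n) * ennreal K))"
      using weighted_moment_le[OF assms, of R n]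
      by (intro mult_left_mono order_trans[OF fourth_moment_Suc_le]) (auto simp: K)
    also have "\<dots> = ennreal (1 / real m ^ (4 * Suc n) * (real m ^ 3 * ((growth * real m ^ 3) ^ n * K)))"
      using K growth_nonneg
      by (simp add: ennreal_mult[symmetric] ennreal_of_nat_eq_real_of_nat ennreal_power)
    also have "1 / real m ^ (4 * Suc n) * (real m ^ 3 * ((growth * real m ^ 3) ^ n * K)) = K / real m * q ^ n"
    proof -
      have "real m ^ (4 * Suc n) = real m ^ 3 * real m * (real m ^ 3) ^ n * real m ^ n"
        by (simp add: add.commute flip: power_mult power_add power_Suc2)
      then show ?thesis using m3 by (simp add: q_def power_divide power_mult_distrib field_simps)
    qed
    finally show ?thesis .
  qed
  \<comment> \<open>The term at 0 is split off because the recursion bounds the fourth moment at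
    \<open>Suc n\<close> by the weighted moment at \<open>n\<close>.\<close>
  have "(\<Sum>n. ennreal (1 / real m ^ (4 * n)) * fourth_moment R n)
      = fourth_moment R 0 + (\<Sum>n. ennreal (1 / real m ^ (4 * Suc n)) * fourth_moment R (Suc n))"
    by (subst suminf_offset[of _ 1]) auto
  also have "\<dots> \<le> fourth_moment R 0 + (\<Sum>n. ennreal (K / real m * q ^ n))"
    by (intro add_left_mono suminf_le le) auto
  also have "(\<Sum>n. ennreal (K / real m * q ^ n)) = ennreal (\<Sum>n. K / real m * q ^ n)"
    using q K by (intro suminf_ennreal2) (auto intro!: summable_mult summable_geometric)
  also have "fourth_moment R 0 + \<dots> < \<infinity>" using moments_0_finite(1)[of R] by simp
  finally show ?thesis by simp
qed

end

section \<open>The Boettcher conjugacy\<close>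

text \<open>Maximum principle on circles of radius close to 1. The boundary condition is a limsup,
  so no boundary values are assumed.\<close>

lemma holomorphic_disc_bound_1:
  fixes K :: "complex \<Rightarrow> complex"
  assumes hol: "K holomorphic_on ball 0 1"
    and bd: "\<And>e::real. e > 0 \<Longrightarrow> \<exists>\<rho><1. \<forall>\<zeta>. \<rho> < cmod \<zeta> \<longrightarrow> cmod \<zeta> < 1 \<longrightarrow> cmod (K \<zeta>) \<le> 1 + e"
    and z: "cmod z < 1"
  shows "cmod (K z) \<le> 1"
proof (rule field_le_epsilon)
  fix e :: real assume "e > 0"
  then obtain \<rho> where \<rho>: "\<rho> < 1" "\<And>\<zeta>. \<rho> < cmod \<zeta> \<Longrightarrow> cmod \<zeta> < 1 \<Longrightarrow> cmod (K \<zeta>) \<le> 1 + e"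
    using bd by blast
  have "max \<rho> (cmod z) < 1" using \<rho> z by simp
  then obtain r where r: "max \<rho> (cmod z) < r" "r < 1" using dense by blast
  have "r > 0" using r by (smt (verit) norm_ge_zero)
  show "cmod (K z) \<le> 1 + e"
  proof (rule maximum_modulus_frontier[where S = "cball 0 r" and f = K])
    show "K holomorphic_on interior (cball 0 r)"
      using r by (intro holomorphic_on_subset[OF hol]) auto
    show "continuous_on (closure (cball 0 r)) K"
      using r by (intro holomorphic_on_imp_continuous_on holomorphic_on_subset[OF hol]) auto
    show "bounded (cball (0::complex) r)" by simp
    show "\<And>\<zeta>. \<zeta> \<in> frontier (cball 0 r) \<Longrightarrow> cmod (K \<zeta>) \<le> 1 + e"
      using r \<open>r > 0\<close> \<rho>(2) by (auto simp: frontier_cball)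
    show "z \<in> cball 0 r" using r by simp
  qed
qed

text \<open>The bound for \<open>G\<close> and for \<open>1 / G\<close> gives modulus 1 throughout,
  and the maximum principle then makes \<open>G\<close> constant.\<close>

lemma holomorphic_disc_unimodular_constant:
  fixes G :: "complex \<Rightarrow> complex"
  assumes hol: "G holomorphic_on ball 0 1"
    and nz: "\<And>\<zeta>. cmod \<zeta> < 1 \<Longrightarrow> G \<zeta> \<noteq> 0"
    and bd1: "\<And>e::real. e > 0 \<Longrightarrow> \<exists>\<rho><1. \<forall>\<zeta>. \<rho> < cmod \<zeta> \<longrightarrow> cmod \<zeta> < 1 \<longrightarrow> cmod (G \<zeta>) \<le> 1 + e"
    and bd2: "\<And>e::real. e > 0 \<Longrightarrow> \<exists>\<rho><1. \<forall>\<zeta>. \<rho> < cmod \<zeta> \<longrightarrow> cmod \<zeta> < 1 \<longrightarrow> cmod (1 / G \<zeta>) \<le> 1 + e"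
  shows "\<exists>c. cmod c = 1 \<and> (\<forall>\<zeta>. cmod \<zeta> < 1 \<longrightarrow> G \<zeta> = c)"
proof -
  have 1: "cmod (G \<zeta>) = 1" if "cmod \<zeta> < 1" for \<zeta>
  proof (rule antisym)
    show "cmod (G \<zeta>) \<le> 1" by (rule holomorphic_disc_bound_1[OF hol bd1 that])
    have "(\<lambda>\<zeta>. 1 / G \<zeta>) holomorphic_on ball 0 1"
      by (intro holomorphic_intros hol) (use nz in auto)
    from holomorphic_disc_bound_1[OF this bd2 that] show "1 \<le> cmod (G \<zeta>)"
      using nz[OF that] by (simp add: norm_divide divide_le_eq)
  qed
  have "G constant_on ball 0 1"
    by (rule maximum_modulus_principle[OF hol _ _ _ _ _, where U = "ball 0 1" and \<xi> = 0]) (auto simp: 1)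
  then obtain c where "\<And>\<zeta>. \<zeta> \<in> ball 0 1 \<Longrightarrow> G \<zeta> = c" unfolding constant_on_def by blast
  then show ?thesis using 1[of 0] by (intro exI[of _ c]) auto
qed

section \<open>The basin and its inversion at a fixed point\<close>

context unicritical
begin

abbreviation "\<Omega> \<equiv> basin_infinity f"

lemma f_in_basin_iff [simp]: "f z \<in> \<Omega> \<longleftrightarrow> z \<in> \<Omega>"
proof -
  have "(\<lambda>n. (f ^^ n) (f z)) = (\<lambda>n. (f ^^ Suc n) z)" by (simp add: funpow_swap1)
  then show ?thesis
    unfolding basin_infinity_def mem_Collect_eq
    using filterlim_sequentially_Suc[of "\<lambda>n. (f ^^ n) z" at_infinity] by simp
qed

lemma funpow_f_in_basin_iff [simp]: "(f ^^ n) z \<in> \<Omega> \<longleftrightarrow> z \<in> \<Omega>"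
  by (induction n) auto

lemma continuous_on_f: "continuous_on S f"
  unfolding f_def[abs_def] by (intro continuous_intros)

lemma continuous_on_funpow_f: "continuous_on S (f ^^ n)"
  by (induction n) (auto simp: id_def intro: continuous_on_compose[unfolded o_def] continuous_on_f)

lemma basin_eventually_large:
  assumes "z \<in> \<Omega>" shows "\<exists>n. cmod ((f ^^ n) z) > r"
proof -
  have "eventually (\<lambda>n. r + 1 \<le> cmod ((f ^^ n) z)) sequentially"
    using assms unfolding basin_infinity_def mem_Collect_eq filterlim_at_infinity_conv_norm_at_top filterlim_at_top by blast
  then obtain n where "r + 1 \<le> cmod ((f ^^ n) z)"
    unfolding eventually_sequentially by blast
  then show ?thesis by (intro exI[of _ n]) simp
qed

text \<open>Escaping orbits enter the given neighbourhood of infinity, so the basin is the union of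
  its preimages under the iterates.\<close>

lemma open_basin:
  assumes "{z. r < cmod z} \<subseteq> \<Omega>"
  shows "open \<Omega>"
proof -
  have "\<Omega> = (\<Union>n. (f ^^ n) -` {z. r < cmod z})"
  proof (intro set_eqI iffI)
    fix z assume "z \<in> \<Omega>"
    then show "z \<in> (\<Union>n. (f ^^ n) -` {z. r < cmod z})" using basin_eventually_large by auto
  next
    fix z assume "z \<in> (\<Union>n. (f ^^ n) -` {z. r < cmod z})"
    then obtain n where "(f ^^ n) z \<in> \<Omega>" using assms by auto
    then show "z \<in> \<Omega>" by simp
  qed
  moreover have "open {z::complex. r < cmod z}" by (intro open_Collect_less continuous_intros)
  ultimately show ?thesis
    using continuous_on_funpow_f by (simp only:) (intro open_UN ballI open_vimage)
qed

text \<open>A root of \<open>z ^ m - z + a\<close>. It does not escape, so inversion at it moves the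
  whole basin into the plane.\<close>

lemma fixed_point_exists: "\<exists>b. f b = b"
proof -
  let ?p = "monom 1 m + [:a, -1:]"
  have "degree ?p = m"
    using m3 by (subst degree_add_eq_left) (auto simp: degree_monom_eq)
  then have "\<not> constant (poly ?p)"
    using m3 constant_degree[of ?p] by simp
  from Fundamental_Theorem_Algebra.fundamental_theorem_of_algebra[OF this]
  obtain z where "poly ?p z = 0" ..
  then show ?thesis
    by (intro exI[of _ z]) (simp add: f_def poly_monom algebra_simps)
qed

lemma fixed_point_not_in_basin:
  assumes "f b = b" shows "b \<notin> \<Omega>"
proof
  assume "b \<in> \<Omega>"
  then obtain n where "cmod ((f ^^ n) b) > cmod b" using basin_eventually_large by blast
  moreover have "(f ^^ n) b = b" using assms by (induction n) auto
  ultimately show False by simp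
qed

text \<open>The coordinate \<open>w = 1 / (z - b)\<close> at a fixed point \<open>b\<close> moves the basin into the plane, with
  \<open>\<infinity>\<close> at the origin; there \<open>f\<close> becomes \<open>w ^ m / chart_denom b w\<close>.\<close>
definition chart_basin :: "complex \<Rightarrow> complex set" where
  "chart_basin b = {w. w = 0 \<or> b + 1 / w \<in> \<Omega>}"

definition chart_denom :: "complex \<Rightarrow> complex \<Rightarrow> complex" where
  "chart_denom b w = (1 + b * w) ^ m - (b * w) ^ m"

definition chart_f :: "complex \<Rightarrow> complex \<Rightarrow> complex" where
  "chart_f b w = w ^ m / chart_denom b w"

definition chart_map :: "complex \<Rightarrow> (complex \<Rightarrow> complex) \<Rightarrow> complex \<Rightarrow> complex" where
  "chart_map b F w = (if w = 0 then 0 else F (b + 1 / w))"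

text \<open>Subtracting \<open>f b\<close> cancels \<open>a\<close> and leaves a difference of
  \<open>m\<close>-th powers.\<close>

lemma f_chart_diff:
  assumes "f b = b" "w \<noteq> 0"
  shows "f (b + 1 / w) - b = chart_denom b w / w ^ m"
proof -
  have "f (b + 1 / w) - b = f (b + 1 / w) - f b" using assms by simp
  also have "\<dots> = (b + 1 / w) ^ m - b ^ m" by (simp add: f_def)
  also have "\<dots> = ((1 + b * w) / w) ^ m - (b * w / w) ^ m"
    using assms by (simp add: add_divide_distrib add.commute)
  also have "\<dots> = chart_denom b w / w ^ m"
    by (simp only: chart_denom_def power_divide diff_divide_distrib)
  finally show ?thesis .
qed

text \<open>A zero away from 0 would mean that \<open>f\<close> sends a point of the basin to
  \<open>b\<close>, which does not escape; at 0 the value is 1.\<close>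

lemma chart_denom_nonzero:
  assumes "f b = b" "w \<in> chart_basin b"
  shows "chart_denom b w \<noteq> 0"
proof (cases "w = 0")
  case True
  then show ?thesis using m3 by (simp add: chart_denom_def power_0_left)
next
  case False
  then have "f (b + 1 / w) \<in> \<Omega>" using assms by (simp add: chart_basin_def)
  then have "f (b + 1 / w) \<noteq> b" using fixed_point_not_in_basin[OF assms(1)] by metis
  then show ?thesis using f_chart_diff[OF assms(1) False] by auto
qed

lemma chart_f_conj:
  assumes "f b = b" "w \<noteq> 0" "chart_denom b w \<noteq> 0"
  shows "b + 1 / chart_f b w = f (b + 1 / w)"
  using f_chart_diff[OF assms(1,2)] by (simp add: chart_f_def algebra_simps)

lemma chart_f_in_basin_iff:
  assumes "f b = b" "chart_denom b w \<noteq> 0"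
  shows "chart_f b w \<in> chart_basin b \<longleftrightarrow> w \<in> chart_basin b"
proof (cases "w = 0")
  case True
  then show ?thesis using m3 by (simp add: chart_f_def chart_basin_def power_0_left)
next
  case False
  then have "chart_f b w \<noteq> 0" using assms by (simp add: chart_f_def)
  then show ?thesis using chart_f_conj[OF assms(1) False assms(2)] False
    by (simp add: chart_basin_def)
qed

text \<open>\<open>w / (1 + b * w)\<close> is the reciprocal of \<open>b + 1 / w\<close>: it passes
  from the chart centred at \<open>b\<close> to the chart 1/z at infinity.\<close>

lemma chart_near_0:
  assumes "r > 0" "{z. r < cmod z} \<subseteq> \<Omega>"
  obtains \<delta> where "\<delta> > 0" "ball (0::complex) \<delta> \<subseteq> chart_basin b"
    "\<And>w::complex. cmod w < \<delta> \<Longrightarrow> 1 + b * w \<noteq> 0 \<and> cmod (w / (1 + b * w)) < 1 / r"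
proof -
  \<comment> \<open>Chosen so that |w| < \<delta> gives |1 + b w| \<ge> 1 - |b| |w| > r |w|.\<close>
  define \<delta> where "\<delta> = 1 / (r + cmod b + 1)"
  have \<delta>: "\<delta> > 0" using assms by (simp add: \<delta>_def add_pos_nonneg)
  have A: "r * cmod w < cmod (1 + b * w)" if "cmod w < \<delta>" for w :: complex
  proof -
    have "(r + cmod b + 1) * cmod w < 1"
      using that assms by (simp add: \<delta>_def field_simps add_pos_nonneg)
    moreover have "1 \<le> cmod (1 + b * w) + cmod b * cmod w"
      using norm_triangle_ineq4[of "1 + b * w" "b * w"] by (simp add: norm_mult)
    ultimately show ?thesis
      using norm_ge_zero[of w] unfolding distrib_right by linarith
  qed
  have B: "1 + b * w \<noteq> 0" if "cmod w < \<delta>" for w :: complex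
    using A[OF that] assms norm_ge_zero[of w] by (auto simp: mult_less_0_iff)
  show ?thesis
  proof (rule that[OF \<delta>])
    show "ball 0 \<delta> \<subseteq> chart_basin b"
    proof
      fix w :: complex assume w: "w \<in> ball 0 \<delta>"
      show "w \<in> chart_basin b"
      proof (cases "w = 0")
        case False
        have "b + 1 / w = (1 + b * w) / w" using False by (simp add: field_simps)
        then have "cmod (b + 1 / w) > r"
          using A[of w] w False by (simp add: norm_divide field_simps)
        then show ?thesis using assms by (auto simp: chart_basin_def)
      qed (simp add: chart_basin_def)
    qed
    show "1 + b * w \<noteq> 0 \<and> cmod (w / (1 + b * w)) < 1 / r" if "cmod w < \<delta>" for w :: complex
      using A[OF that] B[OF that] assms by (simp add: norm_divide field_simps)
  qed
qed

text \<open>Holomorphy is glued from two open pieces: away from 0 through \<open>F\<close> itself,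
  near 0 through the chart of \<open>F\<close> at infinity.\<close>

lemma chart_biholomorphic:
  assumes bih: "biholo_to_disk_infty \<Omega> F 0" and b: "f b = b"
  shows "open (chart_basin b)" "chart_map b F holomorphic_on chart_basin b"
    "inj_on (chart_map b F) (chart_basin b)" "chart_map b F ` chart_basin b = ball 0 1"
proof -
  obtain r where r: "r > 0" "{z. r < cmod z} \<subseteq> \<Omega>"
    and holi: "(\<lambda>w. if w = 0 then 0 else F (1 / w)) holomorphic_on ball 0 (1 / r)"
    and hol: "F holomorphic_on \<Omega>" and inj: "inj_on F \<Omega>" and n0: "0 \<notin> F ` \<Omega>"
    and im: "F ` \<Omega> \<union> {0} = ball 0 1"
    using bih unfolding biholo_to_disk_infty_def by blast
  have bO: "b \<notin> \<Omega>" by (rule fixed_point_not_in_basin[OF b])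
  obtain \<delta> where \<delta>: "\<delta> > 0" "ball (0::complex) \<delta> \<subseteq> chart_basin b"
    "\<And>w::complex. cmod w < \<delta> \<Longrightarrow> 1 + b * w \<noteq> 0 \<and> cmod (w / (1 + b * w)) < 1 / r"
    using chart_near_0[OF r] by blast
  define V where "V = {w. w \<noteq> 0 \<and> b + 1 / w \<in> \<Omega>}"
  have "V = (\<lambda>w. b + 1 / w) -` \<Omega> \<inter> (- {0})" by (auto simp: V_def)
  moreover have "open ((\<lambda>w. b + 1 / w) -` \<Omega> \<inter> (- {0}))"
    unfolding Int_commute[of _ "- {0}"]
    by (intro continuous_open_preimage open_basin[OF r(2)] continuous_intros) auto
  ultimately have oV: "open V" by simp
  have U: "chart_basin b = V \<union> ball 0 \<delta>"
    using \<delta> by (auto simp: V_def chart_basin_def)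
  show "open (chart_basin b)" unfolding U using oV by auto
  have "chart_map b F holomorphic_on V"
  proof (rule holomorphic_transform)
    show "(F \<circ> (\<lambda>w. b + 1 / w)) holomorphic_on V"
      by (intro holomorphic_on_compose_gen[OF _ hol] holomorphic_intros) (auto simp: V_def)
  qed (auto simp: V_def chart_map_def)
  moreover have "chart_map b F holomorphic_on ball 0 \<delta>"
  proof (rule holomorphic_transform)
    show "((\<lambda>w. if w = 0 then 0 else F (1 / w)) \<circ> (\<lambda>w. w / (1 + b * w))) holomorphic_on ball 0 \<delta>"
      by (intro holomorphic_on_compose_gen[OF _ holi] holomorphic_intros) (use \<delta>(3) in auto)
    fix w :: complex assume "w \<in> ball 0 \<delta>"
    then have "1 + b * w \<noteq> 0" using \<delta>(3) by auto
    moreover have "w \<noteq> 0 \<Longrightarrow> b + 1 / w = (1 + b * w) / w" by (simp add: field_simps)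
    ultimately show "((\<lambda>w. if w = 0 then 0 else F (1 / w)) \<circ> (\<lambda>w. w / (1 + b * w))) w = chart_map b F w"
      by (simp add: chart_map_def)
  qed
  ultimately show "chart_map b F holomorphic_on chart_basin b"
    unfolding U using oV by (intro holomorphic_on_Un) auto
  show "inj_on (chart_map b F) (chart_basin b)"
  proof (rule inj_onI)
    fix x y assume xy: "x \<in> chart_basin b" "y \<in> chart_basin b" "chart_map b F x = chart_map b F y"
    have zero: "chart_map b F w = 0 \<longleftrightarrow> w = 0" if "w \<in> chart_basin b" for w
    proof (cases "w = 0")
      case False
      then have "b + 1 / w \<in> \<Omega>" using that by (simp add: chart_basin_def)
      then have "F (b + 1 / w) \<noteq> 0" using n0 by (metis imageI)
      then show ?thesis using False by (simp add: chart_map_def)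
    qed (simp add: chart_map_def)
    have "x = 0 \<longleftrightarrow> y = 0"
      using zero[OF xy(1)] zero[OF xy(2)] xy(3) by simp
    moreover have "x = y" if "x \<noteq> 0" "y \<noteq> 0"
    proof -
      have "b + 1 / x = b + 1 / y"
        using xy that by - (rule inj_onD[OF inj]; simp add: chart_basin_def chart_map_def)
      then show ?thesis using that by simp
    qed
    ultimately show "x = y" by auto
  qed
  have "chart_map b F ` chart_basin b = F ` \<Omega> \<union> {0}"
  proof (intro equalityI subsetI)
    fix u assume "u \<in> F ` \<Omega> \<union> {0}"
    moreover have "F z \<in> chart_map b F ` chart_basin b" if "z \<in> \<Omega>" for z
    proof (rule image_eqI)
      have "z \<noteq> b" using that bO by auto
      then show "F z = chart_map b F (1 / (z - b))" "1 / (z - b) \<in> chart_basin b"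
        using that by (simp_all add: chart_map_def chart_basin_def)
    qed
    moreover have "0 \<in> chart_map b F ` chart_basin b"
      by (rule image_eqI[of _ _ 0]) (simp_all add: chart_map_def chart_basin_def)
    ultimately show "u \<in> chart_map b F ` chart_basin b" by auto
  qed (auto simp: chart_map_def chart_basin_def)
  then show "chart_map b F ` chart_basin b = ball 0 1" using im by simp
qed

text \<open>Properness of \<open>chart_f\<close>: \<open>S\<close> is the preimage of
  \<open>K\<close>, with the denominator cleared so that the condition is closed.\<close>

lemma compact_chart_preimage:
  assumes b: "f b = b" and K: "compact K" "K \<subseteq> chart_basin b"
  defines "S \<equiv> {w. \<exists>k\<in>K. w ^ m = k * chart_denom b w}"
  shows "compact S" "S \<subseteq> chart_basin b"
proof -
  show "S \<subseteq> chart_basin b"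
  proof
    fix w assume "w \<in> S"
    then obtain k where k: "k \<in> K" "w ^ m = k * chart_denom b w" by (auto simp: S_def)
    show "w \<in> chart_basin b"
    proof (cases "w = 0")
      case False
      then have q: "chart_denom b w \<noteq> 0" using k by auto
      then have "chart_f b w = k" using k by (simp add: chart_f_def)
      then show ?thesis using chart_f_in_basin_iff[OF b q] k K by auto
    qed (simp add: chart_basin_def)
  qed
  obtain M where M: "M > 0" "\<And>k. k \<in> K \<Longrightarrow> cmod k \<le> M"
    using compact_imp_bounded[OF K(1)] bounded_pos by metis
  \<comment> \<open>A large \<open>w\<close> stands for a point near \<open>b\<close>, whose image
    is again near \<open>b\<close>, so \<open>chart_f b w\<close> is large too. The bound
    \<open>M\<close> on \<open>K\<close> thus bounds \<open>w\<close> by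
    \<open>1 / \<delta>\<close>.\<close>
  have "continuous (at b) f" using continuous_on_f[of UNIV] continuous_on_eq_continuous_at by blast
  then obtain \<delta> where \<delta>: "\<delta> > 0" "\<And>z. dist z b < \<delta> \<Longrightarrow> dist (f z) (f b) < 1 / M"
    unfolding continuous_at_eps_delta using M by (metis divide_pos_pos zero_less_one)
  have bd: "cmod w \<le> 1 / \<delta>" if "w \<in> S" for w
  proof (cases "w = 0")
    case False
    obtain k where k: "k \<in> K" "w ^ m = k * chart_denom b w" using \<open>w \<in> S\<close> by (auto simp: S_def)
    with False have nz: "k \<noteq> 0" "chart_denom b w \<noteq> 0" by auto
    have "f (b + 1 / w) - b = 1 / k"
      using f_chart_diff[OF b False] k nz by simp
    moreover have "1 / M \<le> cmod (1 / k)"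
      using M(2)[OF k(1)] nz M(1) by (simp add: norm_divide field_simps)
    ultimately have "1 / M \<le> dist (f (b + 1 / w)) (f b)"
      by (simp only: b dist_norm)
    then have "\<delta> \<le> dist (b + 1 / w) b" using \<delta>(2) by (meson not_le)
    then show ?thesis using False \<delta>(1) by (simp add: dist_norm norm_divide field_simps)
  qed (use \<delta> in simp)
  have "S = snd ` ((K \<times> cball 0 (1 / \<delta>)) \<inter> {p. snd p ^ m = fst p * chart_denom b (snd p)})"
  proof (intro equalityI subsetI)
    fix w assume "w \<in> S"
    moreover from this obtain k where "k \<in> K" "w ^ m = k * chart_denom b w" by (auto simp: S_def)
    ultimately show "w \<in> snd ` ((K \<times> cball 0 (1 / \<delta>)) \<inter> {p. snd p ^ m = fst p * chart_denom b (snd p)})"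
      using bd by (intro image_eqI[of _ _ "(k, w)"]) auto
  qed (auto simp: S_def)
  moreover have "compact ((K \<times> cball 0 (1 / \<delta>)) \<inter> {p. snd p ^ m = fst p * chart_denom b (snd p)})"
    unfolding chart_denom_def
    by (intro compact_Int_closed compact_Times K compact_cball closed_Collect_eq continuous_intros)
  ultimately show "compact S"
    using compact_continuous_image[OF continuous_on_snd[OF continuous_on_id]] by simp
qed

text \<open>\<open>g\<close> is \<open>f\<close> transported to the disk. It vanishes only at 0, to
  order \<open>m\<close>, and |g| tends to 1 at the circle because \<open>f\<close> is proper on the
  basin.\<close>

lemma boettcher_conjugacy:
  assumes bih: "biholo_to_disk_infty \<Omega> F 0"
  obtains c where "cmod c = 1" "\<And>z. z \<in> \<Omega> \<Longrightarrow> F (f z) = c * F z ^ m"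
proof -
  obtain b where b: "f b = b" using fixed_point_exists by blast
  define U where "U = chart_basin b"
  define H where "H = chart_map b F"
  note cb = chart_biholomorphic[OF bih b, folded U_def H_def]
  have U0: "0 \<in> U" and H0: "H 0 = 0" by (auto simp: U_def chart_basin_def H_def chart_map_def)
  obtain \<Psi> where hol\<Psi>: "\<Psi> holomorphic_on ball 0 1" and \<Psi>H: "\<And>w. w \<in> U \<Longrightarrow> \<Psi> (H w) = w"
    and d\<Psi>: "\<And>w. w \<in> U \<Longrightarrow> deriv H w * deriv \<Psi> (H w) = 1"
    using holomorphic_has_inverse[OF cb(2,1,3)] cb(4) by metis
  have H\<Psi>: "H (\<Psi> \<zeta>) = \<zeta>" and \<Psi>U: "\<Psi> \<zeta> \<in> U" if "cmod \<zeta> < 1" for \<zeta>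
  proof -
    have "\<zeta> \<in> H ` U" using that cb(4) by simp
    then show "H (\<Psi> \<zeta>) = \<zeta>" "\<Psi> \<zeta> \<in> U" using \<Psi>H by auto
  qed
  have \<Psi>0: "\<Psi> 0 = 0" using \<Psi>H[OF U0] H0 by simp
  \<comment> \<open>Schwarz's lemma supplies the division of \<Psi> by \<zeta>. The quotient
    \<open>k\<close> is zero-free because \<Psi> is injective with nonzero derivative at 0.\<close>
  obtain k where holk: "k holomorphic_on ball 0 1" and k: "\<And>\<zeta>. cmod \<zeta> < 1 \<Longrightarrow> \<Psi> \<zeta> = \<zeta> * k \<zeta>"
    and k0: "deriv \<Psi> 0 = k 0"
    using Schwarz3[OF hol\<Psi> \<Psi>0] by blast
  have knz: "k \<zeta> \<noteq> 0" if "cmod \<zeta> < 1" for \<zeta>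
  proof (cases "\<zeta> = 0")
    case True
    then show ?thesis using d\<Psi>[OF U0] H0 k0 by auto
  next
    case False
    then show ?thesis using k[OF that] H\<Psi>[OF that] H0 by auto
  qed
  define g where "g \<zeta> = H (chart_f b (\<Psi> \<zeta>))" for \<zeta>
  have Q: "chart_denom b (\<Psi> \<zeta>) \<noteq> 0" if "cmod \<zeta> < 1" for \<zeta>
    using chart_denom_nonzero[OF b] \<Psi>U[OF that] by (simp add: U_def)
  have cfU: "chart_f b (\<Psi> \<zeta>) \<in> U" if "cmod \<zeta> < 1" for \<zeta>
    using chart_f_in_basin_iff[OF b Q[OF that]] \<Psi>U[OF that] by (simp add: U_def)
  have g1: "cmod (g \<zeta>) < 1" if "cmod \<zeta> < 1" for \<zeta>
    using cfU[OF that] cb(4) unfolding g_def by auto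
  have \<Psi>g: "\<Psi> (g \<zeta>) = chart_f b (\<Psi> \<zeta>)" if "cmod \<zeta> < 1" for \<zeta>
    using \<Psi>H[OF cfU[OF that]] by (simp add: g_def)
  have holQ: "(\<lambda>\<zeta>. chart_denom b (\<Psi> \<zeta>)) holomorphic_on ball 0 1"
    unfolding chart_denom_def by (intro holomorphic_intros hol\<Psi>)
  have holg: "g holomorphic_on ball 0 1"
  proof -
    have "(H \<circ> (\<lambda>\<zeta>. chart_f b (\<Psi> \<zeta>))) holomorphic_on ball 0 1"
      unfolding chart_f_def
      by (intro holomorphic_on_compose_gen[OF _ cb(2)] holomorphic_intros hol\<Psi> holQ)
         (use Q cfU in \<open>auto simp: chart_f_def\<close>)
    then show ?thesis by (simp add: g_def[abs_def] o_def)
  qed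
  \<comment> \<open>The quotient of \<open>g\<close> by \<open>\<zeta> ^ m\<close>, read off from
    \<open>\<Psi> (g \<zeta>) = chart_f b (\<Psi> \<zeta>)\<close> after factoring \<Psi> on both
    sides; this form is visibly holomorphic at 0.\<close>
  define G where "G \<zeta> = k \<zeta> ^ m / (chart_denom b (\<Psi> \<zeta>) * k (g \<zeta>))" for \<zeta>
  have gG: "g \<zeta> = \<zeta> ^ m * G \<zeta>" if "cmod \<zeta> < 1" for \<zeta>
  proof -
    have "g \<zeta> * k (g \<zeta>) = (\<zeta> * k \<zeta>) ^ m / chart_denom b (\<Psi> \<zeta>)"
      using k[OF g1[OF that]] \<Psi>g[OF that] k[OF that] by (simp add: chart_f_def)
    then have "g \<zeta> = (\<zeta> * k \<zeta>) ^ m / chart_denom b (\<Psi> \<zeta>) / k (g \<zeta>)"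
      using knz[OF g1[OF that]] by (metis nonzero_mult_div_cancel_right)
    then show ?thesis by (simp add: G_def power_mult_distrib)
  qed
  have Gnz: "G \<zeta> \<noteq> 0" if "cmod \<zeta> < 1" for \<zeta>
    using knz[OF that] knz[OF g1[OF that]] Q[OF that] by (simp add: G_def)
  have "(k \<circ> g) holomorphic_on ball 0 1"
    using g1 by (intro holomorphic_on_compose_gen[OF holg holk]) auto
  then have holG: "G holomorphic_on ball 0 1"
    unfolding G_def[abs_def] o_def
    by (intro holomorphic_intros holk holQ) (use knz g1 Q in auto)
  have normG: "cmod (g \<zeta>) = cmod \<zeta> ^ m * cmod (G \<zeta>)" if "cmod \<zeta> < 1" for \<zeta>
    using gG[OF that] by (simp add: norm_mult norm_power)
  have bd1: "\<exists>\<rho><1. \<forall>\<zeta>. \<rho> < cmod \<zeta> \<longrightarrow> cmod \<zeta> < 1 \<longrightarrow> cmod (G \<zeta>) \<le> 1 + e" if "e > 0" for e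
  proof (intro exI conjI allI impI)
    \<comment> \<open>The \<open>m\<close>-th power of this radius is \<open>1 / (1 + e)\<close>,
      which suffices since |\<zeta>|^m |G| = |g| < 1.\<close>
    let ?\<rho> = "root m (1 / (1 + e))"
    show "?\<rho> < 1" using m3 \<open>e > 0\<close> by simp
    fix \<zeta> assume z: "?\<rho> < cmod \<zeta>" "cmod \<zeta> < 1"
    have "1 / (1 + e) = ?\<rho> ^ m" using m3 \<open>e > 0\<close> by simp
    also have "\<dots> \<le> cmod \<zeta> ^ m" using z \<open>e > 0\<close> m3 by (intro power_mono) (auto intro: real_root_ge_zero)
    finally have "1 / (1 + e) * cmod (G \<zeta>) \<le> cmod \<zeta> ^ m * cmod (G \<zeta>)" by (rule mult_right_mono) simp
    also have "\<dots> \<le> 1" using normG[OF z(2)] g1[OF z(2)] by simp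
    finally show "cmod (G \<zeta>) \<le> 1 + e" using \<open>e > 0\<close> by (simp add: field_simps)
  qed
  have bd2: "\<exists>\<rho><1. \<forall>\<zeta>. \<rho> < cmod \<zeta> \<longrightarrow> cmod \<zeta> < 1 \<longrightarrow> cmod (1 / G \<zeta>) \<le> 1 + e" if "e > 0" for e
  proof -
    define t where "t = 1 / (1 + e)"
    have t: "0 < t" "t < 1" using that by (auto simp: t_def)
    \<comment> \<open>If |g| \<le> t at \<zeta>, then \<Psi> maps \<zeta> into the compact set
      \<open>S\<close>, on which |H| has a maximum below 1. Beyond that radius |G| \<ge> |g| >
      t.\<close>
    define K where "K = \<Psi> ` cball 0 t"
    define S where "S = {w. \<exists>k\<in>K. w ^ m = k * chart_denom b w}"
    have "compact K" unfolding K_def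
      using t by (intro compact_continuous_image holomorphic_on_imp_continuous_on holomorphic_on_subset[OF hol\<Psi>]) auto
    moreover have "K \<subseteq> U" using \<Psi>U t by (auto simp: K_def)
    ultimately have S: "compact S" "S \<subseteq> U"
      using compact_chart_preimage[OF b] by (auto simp: S_def U_def)
    have "0 \<in> K" unfolding K_def using t \<Psi>0 by (intro image_eqI[of _ _ 0]) auto
    then have "0 \<in> S" unfolding S_def using m3 by (auto simp: power_0_left intro!: bexI[of _ 0])
    moreover have "continuous_on S (\<lambda>w. cmod (H w))"
      using S cb(2) by (intro continuous_on_norm holomorphic_on_imp_continuous_on holomorphic_on_subset[OF cb(2)])
    ultimately obtain w0 where w0: "w0 \<in> S" "\<And>w. w \<in> S \<Longrightarrow> cmod (H w) \<le> cmod (H w0)"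
      using continuous_attains_sup[OF S(1)] by blast
    have "H w0 \<in> H ` U" using w0(1) S by auto
    then have "cmod (H w0) < 1" unfolding cb(4) by simp
    moreover have "cmod (1 / G \<zeta>) \<le> 1 + e" if z: "cmod (H w0) < cmod \<zeta>" "cmod \<zeta> < 1" for \<zeta>
    proof -
      have "t < cmod (g \<zeta>)"
      proof (rule ccontr)
        assume "\<not> t < cmod (g \<zeta>)"
        then have "\<Psi> (g \<zeta>) \<in> K" by (auto simp: K_def)
        moreover have "\<Psi> \<zeta> ^ m = \<Psi> (g \<zeta>) * chart_denom b (\<Psi> \<zeta>)"
          using \<Psi>g[OF z(2)] Q[OF z(2)] by (simp add: chart_f_def)
        ultimately have "\<Psi> \<zeta> \<in> S" unfolding S_def by blast
        from w0(2)[OF this] show False using H\<Psi>[OF z(2)] z by simp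
      qed
      also have "\<dots> \<le> cmod (G \<zeta>)"
        unfolding normG[OF z(2)] using z by (intro mult_left_le_one_le power_le_one) auto
      finally show ?thesis using \<open>e > 0\<close> Gnz[OF z(2)]
        by (simp add: t_def norm_divide field_simps)
    qed
    ultimately show ?thesis by blast
  qed
  have "\<exists>c. cmod c = 1 \<and> (\<forall>\<zeta>. cmod \<zeta> < 1 \<longrightarrow> G \<zeta> = c)"
    by (rule holomorphic_disc_unimodular_constant[OF holG Gnz bd1 bd2])
  then obtain c where c: "cmod c = 1" "\<And>\<zeta>. cmod \<zeta> < 1 \<Longrightarrow> G \<zeta> = c" by blast
  show ?thesis
  proof (rule that[OF c(1)])
    fix z assume z: "z \<in> \<Omega>"
    then have "z \<noteq> b" using fixed_point_not_in_basin[OF b] by auto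
    define w where "w = 1 / (z - b)"
    have w: "w \<noteq> 0" "b + 1 / w = z" using \<open>z \<noteq> b\<close> by (auto simp: w_def)
    then have wU: "w \<in> U" using z by (simp add: U_def chart_basin_def)
    then have q: "chart_denom b w \<noteq> 0" using chart_denom_nonzero[OF b] by (simp add: U_def)
    have Hw: "H w = F z" using w by (simp add: H_def chart_map_def)
    have "chart_f b w \<noteq> 0" using w q by (simp add: chart_f_def)
    then have Hf: "H (chart_f b w) = F (f z)"
      using chart_f_conj[OF b w(1) q] w by (simp add: H_def chart_map_def)
    have "H w \<in> H ` U" using wU by (rule imageI)
    then have n: "cmod (H w) < 1" unfolding cb(4) by simp
    show "F (f z) = c * F z ^ m"
      using gG[OF n] c(2)[OF n] \<Psi>H[OF wU] Hf Hw by (simp add: g_def)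
  qed
qed

end

section \<open>Integrability of the derivative of the Riemann map\<close>

text \<open>Dyadic covering: the weight at scale 2^k is 4^(-pk) and the area is of order 4^k, a
  geometric series of ratio 4^(1-p).\<close>

lemma nn_integral_inverse_norm_powr_finite:
  fixes p :: real
  assumes "p > 1"
  shows "(\<integral>\<^sup>+ z. ennreal (cmod z powr (- 2 * p)) * indicator {z. 1 \<le> cmod z} z \<partial>lborel) < \<infinity>"
proof -
  define v where "v = unit_ball_vol 2"
  define c :: "nat \<Rightarrow> real" where "c k = 2 powr (- 2 * p * real k)" for k
  have v: "v \<ge> 0" by (simp add: v_def)
  define q :: real where "q = 4 powr (1 - p)"
  have q: "0 \<le> q" "q < 1" using assms by (auto simp: q_def powr_less_one)
  have "(\<integral>\<^sup>+ z. ennreal (cmod z powr (- 2 * p)) * indicator {z. 1 \<le> cmod z} z \<partial>lborel)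
      \<le> (\<integral>\<^sup>+ z. (\<Sum>k. ennreal (c k) * indicator (cball (0::complex) (2 ^ Suc k)) z) \<partial>lborel)"
  proof (rule nn_integral_mono)
    fix z :: complex
    show "ennreal (cmod z powr (- 2 * p)) * indicator {z. 1 \<le> cmod z} z
       \<le> (\<Sum>k. ennreal (c k) * indicator (cball 0 (2 ^ Suc k)) z)"
    proof (cases "1 \<le> cmod z")
      case True
      define k where "k = nat \<lfloor>log 2 (cmod z)\<rfloor>"
      have "0 \<le> log 2 (cmod z)" using True by (subst zero_le_log_cancel_iff) auto
      then have k: "real k \<le> log 2 (cmod z)" "log 2 (cmod z) < real k + 1"
        unfolding k_def by linarith+
      have "2 powr real k \<le> cmod z" "cmod z < 2 powr (real k + 1)"
        using k zero_less_one[THEN less_le_trans, OF True] by (simp_all add: le_log_iff log_less_iff)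
      then have z: "2 powr real k \<le> cmod z" "cmod z \<le> 2 ^ Suc k"
        by (auto simp: powr_add powr_realpow)
      have "cmod z powr (- 2 * p) \<le> (2 powr real k) powr (- 2 * p)"
        using z(1) assms by (intro powr_mono2') auto
      also have "\<dots> = c k" by (simp add: c_def powr_powr mult_ac)
      finally have "ennreal (cmod z powr (- 2 * p)) * indicator {z. 1 \<le> cmod z} z
          \<le> ennreal (c k) * indicator (cball 0 (2 ^ Suc k)) z"
        using True z(2) by (simp add: ennreal_leI)
      also have "\<dots> = (\<Sum>i\<in>{k}. ennreal (c i) * indicator (cball 0 (2 ^ Suc i)) z)"
        by (simp only: sum.insert sum.empty finite.emptyI empty_iff not_False_eq_True add_0_right)
      also have "\<dots> \<le> (\<Sum>k. ennreal (c k) * indicator (cball 0 (2 ^ Suc k)) z)"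
        by (rule sum_le_suminf) auto
      finally show ?thesis .
    qed simp
  qed
  also have "\<dots> = (\<Sum>k. ennreal (c k) * emeasure lborel (cball (0::complex) (2 ^ Suc k)))"
  proof -
    have [measurable]: "cball (0::complex) r \<in> sets borel" for r by simp
    show ?thesis by (subst nn_integral_suminf) (measurable, simp add: nn_integral_cmult_indicator)
  qed
  also have "\<dots> = (\<Sum>k. ennreal (4 * v * q ^ k))"
  proof (rule suminf_cong)
    fix k
    have "c k * (v * (2 ^ Suc k) ^ 2) = 4 * v * q ^ k"
    proof -
      have "c k = (4 powr - p) ^ k"
      proof -
        have "c k = (2 powr 2) powr (- p * real k)" unfolding c_def powr_powr by (simp add: mult.assoc)
        also have "2 powr 2 = (4::real)" by simp
        also have "4 powr (- p * real k) = (4 powr - p) powr real k" unfolding powr_powr ..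
        finally show ?thesis by (simp add: powr_realpow)
      qed
      moreover have "((2::real) ^ Suc k) ^ 2 = 4 * 4 ^ k"
        by (simp add: power_mult_distrib power2_eq_square flip: power_mult_distrib)
      moreover have "q = 4 powr - p * 4" by (simp add: q_def powr_diff powr_minus field_simps)
      ultimately show ?thesis by (simp add: power_mult_distrib)
    qed
    moreover have "emeasure lborel (cball (0::complex) (2 ^ Suc k)) = ennreal (v * (2 ^ Suc k) ^ 2)"
      by (simp add: emeasure_cball v_def)
    moreover have "c k \<ge> 0" by (simp add: c_def)
    ultimately show "ennreal (c k) * emeasure lborel (cball (0::complex) (2 ^ Suc k)) = ennreal (4 * v * q ^ k)"
      using v by (simp only: ennreal_mult[symmetric] mult_nonneg_nonneg zero_le_power2)
  qed
  also have "\<dots> = ennreal (\<Sum>k. 4 * v * q ^ k)"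
    using q v by (intro suminf_ennreal2) (auto intro!: summable_mult summable_geometric)
  also have "\<dots> < \<infinity>" by simp
  finally show ?thesis .
qed

lemma nn_integral_add_indicator_suminf:
  assumes [measurable]: "u \<in> borel_measurable M" "\<And>n. T n \<in> borel_measurable M" "S \<in> sets M"
  shows "(\<integral>\<^sup>+ x. u x + (indicator S x + (\<Sum>n::nat. T n x)) \<partial>M)
    = (\<integral>\<^sup>+ x. u x \<partial>M) + (emeasure M S + (\<Sum>n. \<integral>\<^sup>+ x. T n x \<partial>M))"
  by (simp add: nn_integral_add nn_integral_suminf)

section \<open>Escape estimates and reduction to the fourth moments\<close>

context unicritical
begin

text \<open>Since |z| \<ge> 1 and m \<ge> 3, |z|^m \<ge> |z|^3 \<ge> (\<kappa> + 1) |z|; subtracting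
  |a| \<le> |z| leaves \<kappa> |z|.\<close>

lemma f_expanding:
  assumes "cmod a \<le> cmod z" "(cmod z)\<^sup>2 \<ge> \<kappa> + 1" "\<kappa> \<ge> 0"
  shows "\<kappa> * cmod z \<le> cmod (f z)"
proof -
  have "1 \<le> (cmod z)\<^sup>2" using assms by linarith
  then have "1 \<le> cmod z" by (metis norm_ge_zero one_power2 power2_le_imp_le)
  then have "cmod z ^ 3 \<le> cmod z ^ m" using m3 by (intro power_increasing) auto
  moreover have "(\<kappa> + 1) * cmod z \<le> cmod z ^ 3"
    unfolding power_numeral_reduce
    using mult_right_mono[OF assms(2) norm_ge_zero[of z]] by (simp add: power2_eq_square mult_ac)
  moreover have "cmod z ^ m \<le> cmod (f z) + cmod a"
    using norm_triangle_ineq4[of "f z" a] by (simp add: f_def norm_power)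
  ultimately show ?thesis using assms(1) unfolding distrib_right by linarith
qed

text \<open>The moduli along the orbit never fall below |z|, so the expansion estimate applies at
  every step and growth is geometric.\<close>

lemma in_basin_if_expanding:
  assumes "cmod a \<le> cmod z" "(cmod z)\<^sup>2 \<ge> \<kappa> + 1" "\<kappa> > 1"
  shows "z \<in> \<Omega>"
proof -
  have z0: "cmod z > 0" using assms(2,3) by auto
  have step: "cmod z * \<kappa> ^ n \<le> cmod ((f ^^ n) z)" for n
  proof (induction n)
    case (Suc n)
    have "cmod z * 1 \<le> cmod z * \<kappa> ^ n"
      using assms by (intro mult_left_mono one_le_power) auto
    then have le: "cmod z \<le> cmod ((f ^^ n) z)" using Suc by simp
    then have "(cmod z)\<^sup>2 \<le> (cmod ((f ^^ n) z))\<^sup>2" by (intro power_mono) auto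
    then have "\<kappa> + 1 \<le> (cmod ((f ^^ n) z))\<^sup>2" using assms(2) by linarith
    then have "\<kappa> * cmod ((f ^^ n) z) \<le> cmod (f ((f ^^ n) z))"
      using assms le by (intro f_expanding) auto
    moreover have "\<kappa> * (cmod z * \<kappa> ^ n) \<le> \<kappa> * cmod ((f ^^ n) z)"
      using Suc assms by (intro mult_left_mono) auto
    ultimately show ?case by (simp add: mult_ac)
  qed simp
  have "filterlim (\<lambda>n. \<kappa> ^ n) at_infinity sequentially"
    using assms by (intro filterlim_realpow_sequentially_gt1) auto
  then have "filterlim (\<lambda>n. \<kappa> ^ n) at_top sequentially"
    using assms by (simp add: filterlim_at_infinity_conv_norm_at_top norm_power)
  then have "filterlim (\<lambda>n. cmod z * \<kappa> ^ n) at_top sequentially"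
    using z0 by (intro filterlim_tendsto_pos_mult_at_top[OF tendsto_const])
  then have "filterlim (\<lambda>n. cmod ((f ^^ n) z)) at_top sequentially"
    by (rule filterlim_at_top_mono) (use step in auto)
  then show ?thesis
    unfolding basin_infinity_def mem_Collect_eq filterlim_at_infinity_conv_norm_at_top .
qed

lemma critical_value_large_imp_escape:
  assumes "(cmod a)\<^sup>2 > 2" shows "0 \<in> \<Omega>"
proof -
  \<comment> \<open>\<open>f 0 = a\<close>, and \<kappa> = |a|^2 - 1 exceeds 1.\<close>
  have "f 0 \<in> \<Omega>"
    using assms m3 by (intro in_basin_if_expanding[of _ "(cmod a)\<^sup>2 - 1"]) (auto simp: f_def power_0_left)
  then show ?thesis by simp
qed

text \<open>The threshold 5/2 is \<kappa> + 1 with \<kappa> = 3/2.\<close>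

lemma large_in_basin:
  assumes "(cmod a)\<^sup>2 \<le> 2" "5/2 \<le> (cmod z)\<^sup>2" shows "z \<in> \<Omega>"
proof (rule in_basin_if_expanding[of _ "3/2"])
  have "(cmod a)\<^sup>2 \<le> (cmod z)\<^sup>2" using assms by linarith
  then show "cmod a \<le> cmod z" by (rule power2_le_imp_le) simp
qed (use assms in auto)

text \<open>\<open>n\<close> is the first exit time. It is positive, so a previous iterate exists;
  that one has modulus at most 2, as has \<open>a\<close>, whence the radius
  \<open>2 ^ m + 2\<close>.\<close>

lemma escape_sets_cover:
  assumes a: "(cmod a)\<^sup>2 \<le> 2" and z: "z \<in> \<Omega>" "(cmod z)\<^sup>2 \<le> 5/2"
  shows "\<exists>n. z \<in> escape_set (2 ^ m + 2) n"
proof -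
  define n where "n = (LEAST n. 5/2 < (cmod ((f ^^ n) z))\<^sup>2)"
  obtain k where "cmod ((f ^^ k) z) > 2" using basin_eventually_large[OF z(1)] by blast
  then have "2\<^sup>2 < (cmod ((f ^^ k) z))\<^sup>2" by (intro power_strict_mono) auto
  then have ex: "5/2 < (cmod ((f ^^ k) z))\<^sup>2" by simp
  have n: "5/2 < (cmod ((f ^^ n) z))\<^sup>2" unfolding n_def by (rule LeastI[of _ k]) (rule ex)
  have below: "(cmod ((f ^^ j) z))\<^sup>2 \<le> 5/2" if "j < n" for j
    using not_less_Least[of j "\<lambda>n. 5/2 < (cmod ((f ^^ n) z))\<^sup>2"] that unfolding n_def by auto
  have "n \<noteq> 0" using n z(2) by (cases n) auto
  then obtain j where j: "n = Suc j" by (cases n) auto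
  have "(cmod ((f ^^ j) z))\<^sup>2 \<le> 2\<^sup>2" using below[of j] j by simp
  then have "cmod ((f ^^ j) z) \<le> 2" by (rule power2_le_imp_le) simp
  then have "cmod ((f ^^ j) z) ^ m \<le> 2 ^ m" by (intro power_mono) auto
  moreover have "cmod a \<le> 2" by (rule power2_le_imp_le) (use a in auto)
  ultimately have "cmod ((f ^^ n) z) \<le> 2 ^ m + 2"
    using norm_triangle_ineq[of "(f ^^ j) z ^ m" a] by (simp add: j f_def norm_power)
  then show ?thesis using n below by (intro exI[of _ n]) (auto simp: escape_set_def)
qed

text \<open>Far out the decay |z|^(-2p) is integrable as p > 1. In the disc the exponent is raised
  to 4, where the moments are summable.\<close>

lemma nn_integral_basin_finite:
  fixes g :: "complex \<Rightarrow> real" and p :: real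
  assumes a: "(cmod a)\<^sup>2 \<le> 2" and p: "1 < p" "p \<le> 4"
    and g: "\<And>z. g z \<ge> 0" and C: "C \<ge> 0"
    and far: "\<And>z. 5/2 \<le> (cmod z)\<^sup>2 \<Longrightarrow> g z \<le> C / (cmod z)\<^sup>2"
    and near: "\<And>n z. z \<in> escape_set (2 ^ m + 2) n \<Longrightarrow> g z \<le> C * cmod (iter_deriv n z) / real m ^ n"
  shows "(\<integral>\<^sup>+ z\<in>\<Omega>. ennreal (g z powr p) \<partial>lborel) < \<infinity>"
proof -
  let ?E = "escape_set (2 ^ m + 2)"
  let ?far = "\<lambda>z. ennreal (C powr p) * (ennreal (cmod z powr (- 2 * p)) * indicator {z. 1 \<le> cmod z} z)"
  let ?term = "\<lambda>n z. ennreal (C ^ 4) * (ennreal (1 / real m ^ (4 * n)) * (ennreal (cmod (iter_deriv n z) ^ 4) * indicator (?E n) z))"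
  have le: "ennreal (g z powr p) * indicator \<Omega> z \<le> ?far z + (indicator (cball 0 2) z + (\<Sum>n. ?term n z))" for z
  proof (cases "z \<in> \<Omega>")
    case zO: True
    show ?thesis
    proof (cases "5/2 \<le> (cmod z)\<^sup>2")
      case True
      then have "1\<^sup>2 \<le> (cmod z)\<^sup>2" by simp
      then have z1: "1 \<le> cmod z" by (rule power2_le_imp_le) simp
      have "g z powr p \<le> (C / (cmod z)\<^sup>2) powr p"
        using far[OF True] g p by (intro powr_mono2) auto
      also have "\<dots> = C powr p * cmod z powr (- 2 * p)"
        using z1 C by (simp add: powr_divide powr_powr powr_minus_divide flip: powr_numeral)
      finally have "ennreal (g z powr p) \<le> ?far z"
        using z1 by (simp add: ennreal_mult'[symmetric] ennreal_leI)
      then show ?thesis using zO by (simp add: add_increasing2)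
    next
      case False
      then obtain n where n: "z \<in> ?E n" using escape_sets_cover[OF a zO] by auto
      have "(cmod z)\<^sup>2 \<le> 2\<^sup>2" using False by simp
      then have "cmod z \<le> 2" by (rule power2_le_imp_le) simp
      then have z2: "z \<in> cball 0 2" by simp
      \<comment> \<open>The summand 1 is paid for by the area of \<open>cball 0 2\<close>.\<close>
      have "g z powr p \<le> 1 + g z ^ 4"
      proof (cases "g z \<le> 1")
        case True
        then have "g z powr p \<le> 1 powr p" using g p by (intro powr_mono2) auto
        then show ?thesis by (simp add: add_increasing2)
      next
        case False
        then have "g z powr p \<le> g z powr 4" using p by (intro powr_mono) auto
        then show ?thesis using False by simp
      qed
      also have "g z ^ 4 \<le> (C * cmod (iter_deriv n z) / real m ^ n) ^ 4"
        using near[OF n] g by (intro power_mono) auto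
      also have "\<dots> = C ^ 4 * (1 / real m ^ (4 * n) * cmod (iter_deriv n z) ^ 4)"
        by (simp add: power_divide power_mult_distrib mult.commute flip: power_mult)
      finally have "ennreal (g z powr p) \<le> ennreal (1 + C ^ 4 * (1 / real m ^ (4 * n) * cmod (iter_deriv n z) ^ 4))"
        by (intro ennreal_leI) auto
      also have "\<dots> = 1 + ?term n z"
        using C n by (subst ennreal_plus) (auto simp: ennreal_mult[symmetric])
      also have "?term n z = (\<Sum>i\<in>{n}. ?term i z)" by simp
      also have "\<dots> \<le> (\<Sum>n. ?term n z)" by (rule sum_le_suminf) auto
      finally have "ennreal (g z powr p) \<le> indicator (cball 0 2) z + (\<Sum>n. ?term n z)"
        using z2 by (simp add: add_left_mono)
      then show ?thesis using zO by (simp add: add_increasing)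
    qed
  qed simp
  have "(\<integral>\<^sup>+ z\<in>\<Omega>. ennreal (g z powr p) \<partial>lborel)
     \<le> (\<integral>\<^sup>+ z. ?far z + (indicator (cball 0 2) z + (\<Sum>n. ?term n z)) \<partial>lborel)"
    by (intro nn_integral_mono le)
  also have "\<dots> = (\<integral>\<^sup>+ z. ?far z \<partial>lborel) + (emeasure lborel (cball (0::complex) 2) + (\<Sum>n. \<integral>\<^sup>+ z. ?term n z \<partial>lborel))"
    by (rule nn_integral_add_indicator_suminf) measurable
  also have "(\<lambda>n. \<integral>\<^sup>+ z. ?term n z \<partial>lborel) = (\<lambda>n. ennreal (C ^ 4) * (ennreal (1 / real m ^ (4 * n)) * fourth_moment (2 ^ m + 2) n))"
    by (simp add: nn_integral_cmult fourth_moment_def)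
  also have "(\<Sum>n. ennreal (C ^ 4) * (ennreal (1 / real m ^ (4 * n)) * fourth_moment (2 ^ m + 2) n))
     = ennreal (C ^ 4) * (\<Sum>n. ennreal (1 / real m ^ (4 * n)) * fourth_moment (2 ^ m + 2) n)"
    by (rule ennreal_suminf_cmult)
  also have "(\<integral>\<^sup>+ z. ?far z \<partial>lborel) + (emeasure lborel (cball (0::complex) 2) + \<dots>) < \<infinity>"
    using nn_integral_inverse_norm_powr_finite[OF p(1)] suminf_fourth_moment_finite[of "2 ^ m + 2"] a
      emeasure_lborel_cball_finite[of "0::complex" 2]
    by (simp add: nn_integral_cmult ennreal_mult_less_top)
  finally show ?thesis .
qed

section \<open>Derivative estimates from the conjugacy\<close>

lemma has_field_derivative_f: "(f has_field_derivative of_nat m * z ^ (m - 1)) (at z)"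
  unfolding f_def[abs_def] by (auto intro!: derivative_eq_intros)

lemma conjugacy_deriv:
  assumes bih: "biholo_to_disk_infty \<Omega> F 0"
    and c: "\<And>z. z \<in> \<Omega> \<Longrightarrow> F (f z) = c * F z ^ m"
    and z: "z \<in> \<Omega>"
  shows "deriv F (f z) * (of_nat m * z ^ (m - 1)) = c * (of_nat m * F z ^ (m - 1) * deriv F z)"
proof -
  have hol: "F holomorphic_on \<Omega>" and op: "open \<Omega>"
    using bih open_basin unfolding biholo_to_disk_infty_def by blast+
  have dF: "(F has_field_derivative deriv F u) (at u)" if "u \<in> \<Omega>" for u
    using holomorphic_derivI[OF hol op that] .
  have "((\<lambda>u. F (f u)) has_field_derivative deriv F (f z) * (of_nat m * z ^ (m - 1))) (at z)"
    using DERIV_chain2[OF dF has_field_derivative_f] z by simp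
  moreover have "((\<lambda>u. F (f u)) has_field_derivative c * (of_nat m * F z ^ (m - 1) * deriv F z)) (at z)"
  proof (rule has_field_derivative_transform_within_open[OF _ op z])
    show "((\<lambda>u. c * F u ^ m) has_field_derivative c * (of_nat m * F z ^ (m - 1) * deriv F z)) (at z)"
      using dF[OF z] by (auto intro!: derivative_eq_intros)
  qed (use c in auto)
  ultimately show ?thesis by (rule DERIV_unique)
qed

text \<open>At 0 the left side of the differentiated conjugacy vanishes. The right side does not:
  \<open>F\<close> is injective, so its derivative is nonzero, and the value 0 is reserved for
  infinity.\<close>

lemma critical_point_not_in_basin:
  assumes bih: "biholo_to_disk_infty \<Omega> F 0"
  shows "0 \<notin> \<Omega>"
proof
  assume 0: "0 \<in> \<Omega>"
  obtain c where c: "cmod c = 1" "\<And>z. z \<in> \<Omega> \<Longrightarrow> F (f z) = c * F z ^ m"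
    using boettcher_conjugacy[OF bih] by blast
  have "F holomorphic_on \<Omega>" "open \<Omega>" "inj_on F \<Omega>" "F 0 \<noteq> 0"
    using bih open_basin 0 unfolding biholo_to_disk_infty_def by (blast, blast, blast, metis imageI)
  then have "deriv F 0 \<noteq> 0" "F 0 \<noteq> 0"
    using holomorphic_injective_imp_regular 0 by blast+
  moreover have "c \<noteq> 0" using c(1) by auto
  ultimately show False
    using conjugacy_deriv[OF bih c(2) 0] m3 by (simp add: power_0_left)
qed

lemma iterated_conjugacy:
  assumes bih: "biholo_to_disk_infty \<Omega> F 0"
  shows "z \<in> \<Omega> \<Longrightarrow> cmod (F ((f ^^ n) z)) = cmod (F z) ^ (m ^ n)"
    and "z \<in> \<Omega> \<Longrightarrow> cmod (deriv F ((f ^^ n) z)) * cmod (iter_deriv n z)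
           = real m ^ n * cmod (F z) ^ (m ^ n - 1) * cmod (deriv F z)"
proof -
  obtain c where c: "cmod c = 1" "\<And>z. z \<in> \<Omega> \<Longrightarrow> F (f z) = c * F z ^ m"
    using boettcher_conjugacy[OF bih] by blast
  have norm_f: "cmod (F (f z)) = cmod (F z) ^ m" if "z \<in> \<Omega>" for z
    using c(2)[OF that] c(1) by (simp add: norm_mult norm_power)
  show "z \<in> \<Omega> \<Longrightarrow> cmod (F ((f ^^ n) z)) = cmod (F z) ^ (m ^ n)"
    by (induction n) (auto simp: norm_f mult.commute simp flip: power_mult)
  show "z \<in> \<Omega> \<Longrightarrow> cmod (deriv F ((f ^^ n) z)) * cmod (iter_deriv n z)
           = real m ^ n * cmod (F z) ^ (m ^ n - 1) * cmod (deriv F z)"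
  proof (induction n arbitrary: z)
    case (Suc n)
    have step: "cmod (deriv F (f z)) * cmod (of_nat m * z ^ (m - 1))
        = real m * cmod (F z) ^ (m - 1) * cmod (deriv F z)"
      using arg_cong[OF conjugacy_deriv[OF bih c(2) Suc.prems], of cmod] c(1)
      by (simp add: norm_mult norm_power mult_ac)
    have "m ^ n \<ge> 1" using m3 by simp
    \<comment> \<open>The exponent \<open>m ^ n - 1\<close> of |F| at \<open>f z\<close> is
      multiplied by \<open>m\<close>, and one further step adds \<open>m - 1\<close>.\<close>
    then have exps: "m * (m ^ n - 1) + (m - 1) = m ^ Suc n - 1"
      using m3 by (simp add: diff_mult_distrib2)
    have "cmod (deriv F ((f ^^ Suc n) z)) * cmod (iter_deriv (Suc n) z)
        = (cmod (deriv F ((f ^^ n) (f z))) * cmod (iter_deriv n (f z))) * cmod (of_nat m * z ^ (m - 1))"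
      by (simp add: iter_deriv_Suc funpow_swap1 norm_mult)
    also have "\<dots> = real m ^ n * cmod (F (f z)) ^ (m ^ n - 1) * (cmod (deriv F (f z)) * cmod (of_nat m * z ^ (m - 1)))"
      using Suc.IH[of "f z"] Suc.prems by (simp add: mult_ac)
    also have "\<dots> = real m ^ Suc n * (cmod (F z) ^ (m * (m ^ n - 1)) * cmod (F z) ^ (m - 1)) * cmod (deriv F z)"
      unfolding step norm_f[OF Suc.prems] power_mult by simp
    also have "\<dots> = real m ^ Suc n * cmod (F z) ^ (m ^ Suc n - 1) * cmod (deriv F z)"
      unfolding power_add[symmetric] exps ..
    finally show ?case .
  qed (simp add: iter_deriv_def)
qed

text \<open>Exit points lie in a compact subset \<open>K\<close> of the basin, where |F'| is bounded
  above and |F| below. The iterated identity carries both bounds back to time 0 with a constant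
  independent of \<open>n\<close>.\<close>

lemma deriv_bound_near:
  assumes bih: "biholo_to_disk_infty \<Omega> F 0" and a: "(cmod a)\<^sup>2 \<le> 2"
  obtains C where "C \<ge> 0"
    "\<And>n z. z \<in> escape_set R n \<Longrightarrow> cmod (deriv F z) \<le> C * cmod (iter_deriv n z) / real m ^ n"
proof -
  have hol: "F holomorphic_on \<Omega>" and op: "open \<Omega>" and n0: "0 \<notin> F ` \<Omega>" and im: "F ` \<Omega> \<union> {0} = ball 0 1"
    using bih open_basin unfolding biholo_to_disk_infty_def by blast+
  define K where "K = cball 0 R \<inter> {z. 5/2 \<le> (cmod z)\<^sup>2}"
  have K: "compact K" unfolding K_def
    by (intro compact_Int_closed compact_cball closed_Collect_le continuous_intros)
  have KO: "K \<subseteq> \<Omega>" using large_in_basin[OF a] by (auto simp: K_def)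
  have "continuous_on K (deriv F)"
    using KO op hol by (intro holomorphic_on_imp_continuous_on holomorphic_on_subset[OF holomorphic_deriv[OF hol op]])
  then have "bounded (deriv F ` K)" using K compact_continuous_image compact_imp_bounded by blast
  then obtain M where M: "M > 0" "\<And>z. z \<in> K \<Longrightarrow> cmod (deriv F z) \<le> M"
    unfolding bounded_pos by auto
  have Fnz: "F z \<noteq> 0" if "z \<in> \<Omega>" for z using n0 that by (metis imageI)
  have "continuous_on K (\<lambda>z. 1 / F z)"
    using KO Fnz by (intro continuous_intros holomorphic_on_imp_continuous_on holomorphic_on_subset[OF hol]) auto
  then have "bounded ((\<lambda>z. 1 / F z) ` K)" using K compact_continuous_image compact_imp_bounded by blast
  then obtain N where N: "N > 0" "\<And>z. z \<in> K \<Longrightarrow> cmod (1 / F z) \<le> N"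
    unfolding bounded_pos by auto
  show ?thesis
  proof (rule that[of "M * N"])
    show "0 \<le> M * N" using M N by simp
    fix n z assume z: "z \<in> escape_set R n"
    then have fK: "(f ^^ n) z \<in> K" by (auto simp: escape_set_def K_def)
    then have zO: "z \<in> \<Omega>" using KO by auto
    have "cmod (F z) < 1" using im zO by (metis UnCI imageI mem_ball_0)
    have "1 / N \<le> cmod (F ((f ^^ n) z))"
      using N(2)[OF fK] N(1) Fnz KO fK by (auto simp: norm_divide field_simps)
    also have "\<dots> = cmod (F z) ^ (m ^ n)" by (rule iterated_conjugacy(1)[OF bih zO])
    \<comment> \<open>As |F z| < 1, lowering the exponent by one only increases the power.\<close>
    also have "\<dots> \<le> cmod (F z) ^ (m ^ n - 1)"
      using \<open>cmod (F z) < 1\<close> by (intro power_decreasing) auto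
    finally have low: "1 / N \<le> cmod (F z) ^ (m ^ n - 1)" .
    have "real m ^ n * (1 / N) * cmod (deriv F z) \<le> real m ^ n * cmod (F z) ^ (m ^ n - 1) * cmod (deriv F z)"
      by (intro mult_right_mono mult_left_mono low) auto
    also have "\<dots> = cmod (deriv F ((f ^^ n) z)) * cmod (iter_deriv n z)"
      by (rule iterated_conjugacy(2)[OF bih zO, symmetric])
    also have "\<dots> \<le> M * cmod (iter_deriv n z)"
      by (intro mult_right_mono M fK) auto
    finally show "cmod (deriv F z) \<le> M * N * cmod (iter_deriv n z) / real m ^ n"
      using N(1) m3 by (simp add: field_simps)
  qed
qed

text \<open>With L(w) = F(1/w) holomorphic near 0, F'(z) = -L'(1/z) / z^2; the remaining bounded
  region is compact in the basin.\<close>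

lemma deriv_bound_far:
  assumes bih: "biholo_to_disk_infty \<Omega> F Finf" and a: "(cmod a)\<^sup>2 \<le> 2"
  obtains C where "C \<ge> 0" "\<And>z. 5/2 \<le> (cmod z)\<^sup>2 \<Longrightarrow> cmod (deriv F z) \<le> C / (cmod z)\<^sup>2"
proof -
  obtain r where r: "r > 0" "{z. r < cmod z} \<subseteq> \<Omega>"
    and holi: "(\<lambda>w. if w = 0 then Finf else F (1 / w)) holomorphic_on ball 0 (1 / r)"
    and hol: "F holomorphic_on \<Omega>"
    using bih unfolding biholo_to_disk_infty_def by blast
  have op: "open \<Omega>" by (rule open_basin[OF r(2)])
  define L where "L = (\<lambda>w. if w = 0 then Finf else F (1 / w))"
  note holi = holi[folded L_def]
  define K1 where "K1 = cball 0 (2 * r) \<inter> {z. 5/2 \<le> (cmod z)\<^sup>2}"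
  have "compact K1" unfolding K1_def
    by (intro compact_Int_closed compact_cball closed_Collect_le continuous_intros)
  moreover have "K1 \<subseteq> \<Omega>" using large_in_basin[OF a] by (auto simp: K1_def)
  then have "continuous_on K1 (deriv F)"
    by (intro holomorphic_on_imp_continuous_on holomorphic_on_subset[OF holomorphic_deriv[OF hol op]])
  ultimately have "bounded (deriv F ` K1)" using compact_continuous_image compact_imp_bounded by blast
  then obtain M where M: "M > 0" "\<And>z. z \<in> K1 \<Longrightarrow> cmod (deriv F z) \<le> M"
    unfolding bounded_pos by auto
  \<comment> \<open>Halving the radius gives a compact disc inside the chart, on which
    \<open>deriv L\<close> is bounded.\<close>
  have "cball 0 (1 / (2 * r)) \<subseteq> ball (0::complex) (1 / r)"
    using r by (auto simp: field_simps)
  then have "continuous_on (cball 0 (1 / (2 * r))) (deriv L)"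
    by (intro holomorphic_on_imp_continuous_on holomorphic_on_subset[OF holomorphic_deriv[OF holi]]) auto
  then have "bounded (deriv L ` cball 0 (1 / (2 * r)))"
    using compact_continuous_image compact_imp_bounded compact_cball by blast
  then obtain N where N: "N > 0" "\<And>w. w \<in> cball 0 (1 / (2 * r)) \<Longrightarrow> cmod (deriv L w) \<le> N"
    unfolding bounded_pos by auto
  show ?thesis
  proof (rule that[of "M * (2 * r)\<^sup>2 + N"])
    show "0 \<le> M * (2 * r)\<^sup>2 + N" using M N by simp
    fix z :: complex assume z: "5/2 \<le> (cmod z)\<^sup>2"
    then have z0: "(cmod z)\<^sup>2 > 0" "z \<noteq> 0" by auto
    show "cmod (deriv F z) \<le> (M * (2 * r)\<^sup>2 + N) / (cmod z)\<^sup>2"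
    proof (cases "cmod z \<le> 2 * r")
      case True
      have "cmod (deriv F z) * (cmod z)\<^sup>2 \<le> M * (2 * r)\<^sup>2"
        using M True z by (intro mult_mono M power_mono) (auto simp: K1_def)
      then have "cmod (deriv F z) * (cmod z)\<^sup>2 \<le> M * (2 * r)\<^sup>2 + N" using N by simp
      then show ?thesis using z0 by (simp add: pos_le_divide_eq)
    next
      case False
      then have w: "1 / z \<in> cball 0 (1 / (2 * r))" "1 / z \<in> ball 0 (1 / r)" "r < cmod z"
        using r z0 by (auto simp: norm_divide field_simps)
      have "(L has_field_derivative deriv L (1 / z)) (at (1 / z))"
        using holomorphic_derivI[OF holi open_ball w(2)] .
      moreover have "((\<lambda>u. 1 / u) has_field_derivative - 1 / z ^ 2) (at z)"
        using z0 by (auto intro!: derivative_eq_intros simp: power2_eq_square)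
      ultimately have "((\<lambda>u. L (1 / u)) has_field_derivative deriv L (1 / z) * (- 1 / z ^ 2)) (at z)"
        by (rule DERIV_chain2)
      then have "(F has_field_derivative deriv L (1 / z) * (- 1 / z ^ 2)) (at z)"
      proof (rule has_field_derivative_transform_within_open)
        show "open {u::complex. r < cmod u}" by (intro open_Collect_less continuous_intros)
        show "\<And>u. u \<in> {u. r < cmod u} \<Longrightarrow> L (1 / u) = F u" using r by (auto simp: L_def)
      qed (use w in auto)
      then have "deriv F z = deriv L (1 / z) * (- 1 / z ^ 2)" by (rule DERIV_imp_deriv)
      then have "cmod (deriv F z) = cmod (deriv L (1 / z)) / (cmod z)\<^sup>2"
        by (simp add: norm_mult norm_divide norm_power)
      also have "\<dots> \<le> (M * (2 * r)\<^sup>2 + N) / (cmod z)\<^sup>2"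
        using N(2)[OF w(1)] M(1) by (intro divide_right_mono add_increasing) auto
      finally show ?thesis .
    qed
  qed
qed

text \<open>\<open>F\<close> is followed by the disk automorphism \<mu> taking \<open>Finf\<close>
  to 0. Its derivative is bounded away from 0 on the disk, so integrability bounds transfer
  back.\<close>

lemma biholo_normalize:
  assumes bih: "biholo_to_disk_infty \<Omega> F Finf"
  obtains F0 C where "biholo_to_disk_infty \<Omega> F0 0" "C \<ge> 0"
    "\<And>z. z \<in> \<Omega> \<Longrightarrow> cmod (deriv F z) \<le> C * cmod (deriv F0 z)"
proof -
  obtain r where r: "r > 0" "{z. r < cmod z} \<subseteq> \<Omega>"
    and holi: "(\<lambda>w. if w = 0 then Finf else F (1 / w)) holomorphic_on ball 0 (1 / r)"
    and hol: "F holomorphic_on \<Omega>" and inj: "inj_on F \<Omega>" and nin: "Finf \<notin> F ` \<Omega>"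
    and im: "F ` \<Omega> \<union> {Finf} = ball 0 1"
    using bih unfolding biholo_to_disk_infty_def by blast
  have op: "open \<Omega>" by (rule open_basin[OF r(2)])
  have Finf: "cmod Finf < 1" using im by (metis UnCI mem_ball_0 singletonI)
  have F1: "cmod (F z) < 1" if "z \<in> \<Omega>" for z using im that by (metis UnCI imageI mem_ball_0)
  define \<mu> where "\<mu> = Moebius_function 0 Finf"
  have hol\<mu>: "\<mu> holomorphic_on ball 0 1" unfolding \<mu>_def by (rule Moebius_function_holomorphic[OF Finf])
  have \<mu>1: "cmod (\<mu> \<zeta>) < 1" if "cmod \<zeta> < 1" for \<zeta>
    unfolding \<mu>_def by (rule Moebius_function_norm_lt_1[OF Finf that])
  have \<mu>0: "\<mu> Finf = 0" by (simp add: \<mu>_def Moebius_function_eq_zero)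
  define \<nu> where "\<nu> = Moebius_function 0 (- Finf)"
  have \<nu>\<mu>: "\<nu> (\<mu> \<zeta>) = \<zeta>" "\<mu> (\<nu> \<zeta>) = \<zeta>" if "cmod \<zeta> < 1" for \<zeta>
    unfolding \<nu>_def \<mu>_def
    using Moebius_function_compose[of "- Finf" Finf \<zeta>] Moebius_function_compose[of Finf "- Finf" \<zeta>] that Finf by auto
  have \<nu>1: "cmod (\<nu> \<zeta>) < 1" if "cmod \<zeta> < 1" for \<zeta>
    unfolding \<nu>_def using Moebius_function_norm_lt_1[of "- Finf" \<zeta>] Finf that by simp
  have inj\<mu>: "inj_on \<mu> (ball 0 1)" by (rule inj_on_inverseI[of _ \<nu>]) (use \<nu>\<mu> in auto)
  have im\<mu>: "\<mu> ` ball 0 1 = ball 0 1"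
  proof (intro equalityI subsetI)
    fix \<zeta> :: complex assume "\<zeta> \<in> ball 0 1"
    then show "\<zeta> \<in> \<mu> ` ball 0 1" using \<nu>\<mu>(2)[of \<zeta>] \<nu>1[of \<zeta>] by (intro image_eqI[of _ _ "\<nu> \<zeta>"]) auto
  qed (use \<mu>1 in auto)
  have bih0: "biholo_to_disk_infty \<Omega> (\<mu> \<circ> F) 0"
    unfolding biholo_to_disk_infty_def
  proof (intro conjI exI[of _ r])
    show "(\<mu> \<circ> F) holomorphic_on \<Omega>"
      using F1 by (intro holomorphic_on_compose_gen[OF hol hol\<mu>]) auto
    have "(\<mu> \<circ> (\<lambda>w. if w = 0 then Finf else F (1 / w))) holomorphic_on ball 0 (1 / r)"
    proof (rule holomorphic_on_compose_gen[OF holi hol\<mu>])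
      have "F (1 / w) \<in> ball 0 1" if "w \<noteq> 0" "w \<in> ball 0 (1 / r)" for w
      proof -
        have "r < cmod (1 / w)" using that r by (simp add: norm_divide field_simps)
        then show ?thesis using F1[of "1 / w"] r(2) by auto
      qed
      then show "(\<lambda>w. if w = 0 then Finf else F (1 / w)) ` ball 0 (1 / r) \<subseteq> ball 0 1"
        using Finf by auto
    qed
    then show "(\<lambda>w. if w = 0 then 0 else (\<mu> \<circ> F) (1 / w)) holomorphic_on ball 0 (1 / r)"
      by (rule holomorphic_transform) (auto simp: \<mu>0)
    show "inj_on (\<mu> \<circ> F) \<Omega>"
      using F1 by (intro comp_inj_on inj inj_on_subset[OF inj\<mu>]) auto
    show "0 \<notin> (\<mu> \<circ> F) ` \<Omega>"
    proof
      assume "0 \<in> (\<mu> \<circ> F) ` \<Omega>"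
      then obtain z where z: "z \<in> \<Omega>" "\<mu> (F z) = \<mu> Finf" by (auto simp: \<mu>0)
      then have "F z = Finf" using inj_onD[OF inj\<mu>] F1 Finf by auto
      then show False using nin z by auto
    qed
    have "(\<mu> \<circ> F) ` \<Omega> \<union> {0} = \<mu> ` (F ` \<Omega> \<union> {Finf})" by (auto simp: \<mu>0)
    then show "(\<mu> \<circ> F) ` \<Omega> \<union> {0} = ball 0 1" unfolding im im\<mu> .
  qed (use r in auto)
  define d where "d = 1 - (cmod Finf)\<^sup>2"
  have "(cmod Finf)\<^sup>2 < 1\<^sup>2" using Finf by (intro power_strict_mono) auto
  then have d: "d > 0" by (simp add: d_def)
  \<comment> \<open>The derivative of \<mu> has modulus \<open>d\<close> / |1 - cnj Finf \<zeta>|^2,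
    and the denominator is below 4.\<close>
  have der\<mu>: "d / 4 \<le> cmod (deriv \<mu> \<zeta>)" if "cmod \<zeta> < 1" for \<zeta>
  proof -
    let ?q = "1 - cnj Finf * \<zeta>"
    have "cmod (cnj Finf * \<zeta>) < 1"
      using mult_strict_mono'[OF Finf that] by (simp add: norm_mult)
    then have q: "?q \<noteq> 0" "cmod ?q < 2"
      using norm_triangle_ineq4[of 1 "cnj Finf * \<zeta>"] by auto
    have "(\<mu> has_field_derivative ((1 * ?q - (\<zeta> - Finf) * (- cnj Finf)) / (?q * ?q))) (at \<zeta>)"
      unfolding \<mu>_def Moebius_function_simple[abs_def]
      using q by (auto intro!: derivative_eq_intros)
    then have "deriv \<mu> \<zeta> = (1 - Finf * cnj Finf) / (?q * ?q)"
      by (simp add: DERIV_imp_deriv algebra_simps)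
    also have "1 - Finf * cnj Finf = of_real d"
      by (simp add: d_def complex_norm_square del: of_real_power)
    finally have "cmod (deriv \<mu> \<zeta>) = d / (cmod ?q)\<^sup>2"
      using d by (simp add: norm_divide norm_mult power2_eq_square)
    moreover have "(cmod ?q)\<^sup>2 \<le> 2\<^sup>2" using q by (intro power_mono) auto
    moreover have "0 < (cmod ?q)\<^sup>2" using q by simp
    ultimately show ?thesis using d by (simp only: power2_eq_square) (intro divide_left_mono; simp)
  qed
  show ?thesis
  proof (rule that[OF bih0, of "4 / d"])
    show "0 \<le> 4 / d" using d by simp
    fix z assume z: "z \<in> \<Omega>"
    have "((\<lambda>u. \<mu> (F u)) has_field_derivative deriv \<mu> (F z) * deriv F z) (at z)"
      by (rule DERIV_chain2[OF holomorphic_derivI[OF hol\<mu>] holomorphic_derivI[OF hol op z]])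
         (use F1[OF z] in auto)
    then have "deriv (\<mu> \<circ> F) z = deriv \<mu> (F z) * deriv F z"
      by (simp add: DERIV_imp_deriv o_def)
    then have "d / 4 * cmod (deriv F z) \<le> cmod (deriv (\<mu> \<circ> F) z)"
      using mult_right_mono[OF der\<mu>[OF F1[OF z]] norm_ge_zero] by (simp add: norm_mult)
    then show "cmod (deriv F z) \<le> 4 / d * cmod (deriv (\<mu> \<circ> F) z)"
      using d by (simp add: field_simps)
  qed
qed

text \<open>A Riemann map keeps the critical point out of the basin, whence |a|^2 \<le> 2. The far
  bound is taken for \<open>F\<close> directly; the near bound passes through the normalised
  \<open>F0\<close> at the cost of \<open>B\<close>.\<close>

theorem brennan_basin: "brennan_holds_infty \<Omega>"
  unfolding brennan_holds_infty_def
proof (intro allI impI, elim conjE)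
  fix F Finf and p :: real
  assume bih: "biholo_to_disk_infty \<Omega> F Finf" and p: "4/3 < p" "p < 4"
  obtain F0 B where F0: "biholo_to_disk_infty \<Omega> F0 0" "B \<ge> 0"
    "\<And>z. z \<in> \<Omega> \<Longrightarrow> cmod (deriv F z) \<le> B * cmod (deriv F0 z)"
    using biholo_normalize[OF bih] by blast
  have a: "(cmod a)\<^sup>2 \<le> 2"
    using critical_value_large_imp_escape critical_point_not_in_basin[OF F0(1)] by fastforce
  obtain C1 where C1: "C1 \<ge> 0" "\<And>z. 5/2 \<le> (cmod z)\<^sup>2 \<Longrightarrow> cmod (deriv F z) \<le> C1 / (cmod z)\<^sup>2"
    using deriv_bound_far[OF bih a] by blast
  obtain C2 where C2: "C2 \<ge> 0"
    "\<And>n z. z \<in> escape_set (2 ^ m + 2) n \<Longrightarrow> cmod (deriv F0 z) \<le> C2 * cmod (iter_deriv n z) / real m ^ n"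
    using deriv_bound_near[OF F0(1) a] by blast
  show "(\<integral>\<^sup>+ z\<in>\<Omega>. ennreal (cmod (deriv F z) powr p) \<partial>lborel) < \<infinity>"
  proof (rule nn_integral_basin_finite[OF a, where C = "C1 + B * C2"])
    show "0 \<le> C1 + B * C2" using C1 C2 F0 by simp
    fix z :: complex assume z: "5/2 \<le> (cmod z)\<^sup>2"
    have "cmod (deriv F z) \<le> C1 / (cmod z)\<^sup>2" by (rule C1(2)[OF z])
    also have "\<dots> \<le> (C1 + B * C2) / (cmod z)\<^sup>2" using C2 F0 by (intro divide_right_mono) auto
    finally show "cmod (deriv F z) \<le> (C1 + B * C2) / (cmod z)\<^sup>2" .
  next
    fix n z assume z: "z \<in> escape_set (2 ^ m + 2) n"
    then have "(f ^^ n) z \<in> \<Omega>" by (intro large_in_basin[OF a]) (simp add: escape_set_def)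
    then have "cmod (deriv F z) \<le> B * cmod (deriv F0 z)" by (intro F0(3)) simp
    also have "\<dots> \<le> B * (C2 * cmod (iter_deriv n z) / real m ^ n)"
      by (intro mult_left_mono C2(2)[OF z] F0(2))
    also have "\<dots> \<le> (C1 + B * C2) * cmod (iter_deriv n z) / real m ^ n"
      using C1 by (simp add: divide_right_mono distrib_right mult.assoc)
    finally show "cmod (deriv F z) \<le> (C1 + B * C2) * cmod (iter_deriv n z) / real m ^ n" .
  qed (use p in auto)
qed

end

theorem mainTheorem1:
  fixes m :: nat and a0 :: complex
  assumes "m \<ge> 3"
    and "simply_connected (with_infty (basin_infinity (\<lambda>z. z ^ m + a0)))"
  shows "brennan_holds_infty (basin_infinity (\<lambda>z. z ^ m + a0))"
proof -
  interpret unicritical m a0 by unfold_locales (rule assms(1))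
  have "f = (\<lambda>z. z ^ m + a0)" by (simp add: f_def fun_eq_iff)
  then show ?thesis using brennan_basin by simp
qed

end
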